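(* Let $d\ge 1$ and let $Y$ be a nonempty $\mathbb Z^d$-SFT with computable language. Then the problem "$X=Y$ for effective inputs $X$" is $D(\Sigma^0_1)$-complete.
   Context: For a finite alphabet $\mathcal A$ (a finite subset of $\mathbb N$), a pattern is a function $p\colon S\to\mathcal A$ with $S\subset\mathbb Z^d$ finite; it appears in $x\in\mathcal A^{\mathbb Z^d}$ if there is $u\in\mathbb Z^d$ with $x(u+s)=p(s)$ for all $s\in S$. For a set $\mathcal F$ of patterns, $X_{\mathcal F}$ is the set of configurations in which no pattern from $\mathcal F$ appears. A subshift is a set of the form $X_{\mathcal F}$ (possibly empty); it is an SFT if $\mathcal F$ can be taken finite, and effective if $\mathcal F$ can be taken recursively enumerable. The language of $Y$ is the set of patterns appearing in some configuration of $Y$. The subshift $Y$ is a fixed parameter. The problem is: given an effective $\mathbb Z^d$-subshift $X$ on an arbitrary finite alphabet, specified by the alphabet and a Turing machine enumerating a defining set of forbidden patterns, determine whether $X=Y$. A set belongs to $D(\Sigma^0_1)$ when it is the difference of two $\Sigma^0_1$ sets; completeness is with respect to many-one reductions. *)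

theory Defs
  imports Main "HOL-Library.FuncSet" "HOL-Library.Nat_Bijection"
begin

section \<open>Subshifts over \<open>\<int>\<^sup>d\<close>\<close>

text \<open>Points of \<open>\<int>\<^sup>d\<close> are integer lists of length \<open>d\<close>.  Alphabets are finite sets of natural
  numbers.  Configurations are extensional functions, so that equality of sets of configurations
  only depends on their values on \<open>\<int>\<^sup>d\<close>; in particular, subshifts that are given
  over different alphabets can be compared.\<close>

definition lattice :: "nat \<Rightarrow> int list set" where
  "lattice d = {v. length v = d}"

definition vec_add :: "int list \<Rightarrow> int list \<Rightarrow> int list" where
  "vec_add u v = map2 (+) u v"

type_synonym configuration = "int list \<Rightarrow> nat"

definition full_shift :: "nat \<Rightarrow> nat set \<Rightarrow> configuration set" where
  "full_shift d A = lattice d \<rightarrow>\<^sub>E A"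

text \<open>A pattern \<open>p : S \<rightarrow> A\<close> is a partial function with finite domain \<open>S\<close>.
  The case \<open>S = {}\<close> is allowed.\<close>

type_synonym pattern = "int list \<rightharpoonup> nat"

definition patterns :: "nat \<Rightarrow> nat set \<Rightarrow> pattern set" where
  "patterns d A = {p. finite (dom p) \<and> dom p \<subseteq> lattice d \<and> ran p \<subseteq> A}"

definition appears :: "nat \<Rightarrow> pattern \<Rightarrow> configuration \<Rightarrow> bool" where
  "appears d p x \<longleftrightarrow> (\<exists>u \<in> lattice d. \<forall>s \<in> dom p. p s = Some (x (vec_add u s)))"

definition subshift :: "nat \<Rightarrow> nat set \<Rightarrow> pattern set \<Rightarrow> configuration set" where
  "subshift d A F = {x \<in> full_shift d A. \<forall>p \<in> F. \<not> appears d p x}"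

definition is_SFT :: "nat \<Rightarrow> configuration set \<Rightarrow> bool" where
  "is_SFT d Y \<longleftrightarrow> (\<exists>A F. finite A \<and> finite F \<and> F \<subseteq> patterns d A \<and> Y = subshift d A F)"

definition language :: "nat \<Rightarrow> configuration set \<Rightarrow> pattern set" where
  "language d Y = {p \<in> patterns d UNIV. \<exists>x \<in> Y. appears d p x}"


section \<open>Turing machines\<close>

text \<open>Deterministic machines with a single two-way infinite tape.  States and tape symbols are
  natural numbers; state 0 is initial and symbol 0 is the blank.  A machine is its transition table,
  a partial function that has to be finite; it halts when no transition applies.\<close>

datatype move = MoveLeft | Stay | MoveRight

type_synonym tm = "nat \<times> nat \<rightharpoonup> nat \<times> nat \<times> move"

type_synonym tm_config = "nat \<times> int \<times> (int \<Rightarrow> nat)"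

fun shift_of :: "move \<Rightarrow> int" where
  "shift_of MoveLeft = -1"
| "shift_of Stay = 0"
| "shift_of MoveRight = 1"

fun tm_step :: "tm \<Rightarrow> tm_config \<Rightarrow> tm_config option" where
  "tm_step M (q, h, t) =
     (case M (q, t h) of
        None \<Rightarrow> None
      | Some (q', a, m) \<Rightarrow> Some (q', h + shift_of m, t(h := a)))"

definition tm_init :: "nat \<Rightarrow> tm_config" where
  "tm_init n = (0, 0, \<lambda>i. if 0 \<le> i \<and> i < int n then 1 else 0)"

text \<open>Input and output are in unary: the output is the length of the maximal block of ones
  that starts at the final head position and extends to the right.\<close>

definition tm_result :: "tm \<Rightarrow> nat \<Rightarrow> nat \<Rightarrow> bool" where
  "tm_result M n k \<longleftrightarrow>
     (\<exists>q h t. (\<lambda>c c'. tm_step M c = Some c')\<^sup>*\<^sup>* (tm_init n) (q, h, t) \<and>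
        tm_step M (q, h, t) = None \<and>
        (\<forall>i<k. t (h + int i) = 1) \<and> t (h + int k) \<noteq> 1)"

lemma tm_result_unique:
  assumes "tm_result M n k" and "tm_result M n k'"
  shows "k = k'"
proof -
  let ?R = "\<lambda>c c'. tm_step M c = Some c'"
  have halt: "d = e" if "?R\<^sup>*\<^sup>* c d" "?R\<^sup>*\<^sup>* c e" "tm_step M d = None" "tm_step M e = None" for c d e
    using that
  proof (induction rule: converse_rtranclp_induct)
    case base
    from base(1) show ?case by (cases rule: converse_rtranclpE) (use base(2) in auto)
  next
    case (step y z)
    note IH = step.IH and prems = step.prems(2,3)
    from step.prems(1) show ?case
    proof (cases rule: converse_rtranclpE)
      case base
      then show ?thesis using step.hyps(1) step.prems(3) by simp
    next
      case (step w)
      with \<open>tm_step M y = Some z\<close> have "w = z" by simp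
      with step(2) show ?thesis using IH prems by blast
    qed
  qed
  obtain q h t where 1: "?R\<^sup>*\<^sup>* (tm_init n) (q, h, t)" "tm_step M (q, h, t) = None"
    "\<forall>i<k. t (h + int i) = 1" "t (h + int k) \<noteq> 1"
    using assms(1) unfolding tm_result_def by blast
  obtain q' h' t' where 2: "?R\<^sup>*\<^sup>* (tm_init n) (q', h', t')" "tm_step M (q', h', t') = None"
    "\<forall>i<k'. t' (h' + int i) = 1" "t' (h' + int k') \<noteq> 1"
    using assms(2) unfolding tm_result_def by blast
  have "(q, h, t) = (q', h', t')" by (rule halt[OF 1(1) 2(1) 1(2) 2(2)])
  then show ?thesis using 1 2 by (cases k k' rule: linorder_cases) auto
qed

text \<open>\<open>M\<close> enumerates the outputs of its halting computations on inputs 0, 1, 2, \<open>\<dots>\<close>\<close>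

definition tm_enumerates :: "tm \<Rightarrow> nat set" where
  "tm_enumerates M = {k. \<exists>n. tm_result M n k}"


section \<open>Computability and completeness\<close>

definition computable :: "(nat \<Rightarrow> nat) \<Rightarrow> bool" where
  "computable f \<longleftrightarrow> (\<exists>M. finite (dom M) \<and> (\<forall>n. tm_result M n (f n)))"

definition decidable :: "nat set \<Rightarrow> bool" where
  "decidable S \<longleftrightarrow> computable (\<lambda>n. if n \<in> S then 1 else 0)"

definition Sigma01 :: "nat set \<Rightarrow> bool" where
  "Sigma01 S \<longleftrightarrow> (\<exists>M. finite (dom M) \<and> S = tm_enumerates M)"

definition D_Sigma01 :: "nat set \<Rightarrow> bool" where
  "D_Sigma01 S \<longleftrightarrow> (\<exists>U V. Sigma01 U \<and> Sigma01 V \<and> S = U - V)"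

definition many_one_reducible :: "nat set \<Rightarrow> nat set \<Rightarrow> bool" where
  "many_one_reducible S T \<longleftrightarrow> (\<exists>f. computable f \<and> (\<forall>n. n \<in> S \<longleftrightarrow> f n \<in> T))"

definition D_Sigma01_complete :: "nat set \<Rightarrow> bool" where
  "D_Sigma01_complete T \<longleftrightarrow> D_Sigma01 T \<and> (\<forall>S. D_Sigma01 S \<longrightarrow> many_one_reducible S T)"


section \<open>Codes for patterns, machines and problem instances\<close>

text \<open>Both codings are total on the natural numbers and onto the finite partial functions, which
  they represent by association lists (the first entry for a key counts).\<close>

definition pattern_entry_of :: "nat \<Rightarrow> int list \<times> nat" where
  "pattern_entry_of n = (let (v, a) = prod_decode n in (map int_decode (list_decode v), a))"

definition pattern_of :: "nat \<Rightarrow> pattern" where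
  "pattern_of n = map_of (map pattern_entry_of (list_decode n))"

definition move_of :: "nat \<Rightarrow> move" where
  "move_of n = (if n = 0 then MoveLeft else if n = 1 then Stay else MoveRight)"

definition transition_of :: "nat \<Rightarrow> (nat \<times> nat) \<times> (nat \<times> nat \<times> move)" where
  "transition_of n =
     (let (k, r) = prod_decode n; (q', s) = prod_decode r; (a, m) = prod_decode s
      in (prod_decode k, (q', a, move_of m)))"

definition tm_of :: "nat \<Rightarrow> tm" where
  "tm_of n = map_of (map transition_of (list_decode n))"

lemma finite_map_as_map_of:
  assumes "finite (dom p)"
  shows "\<exists>xs. map_of xs = p"
proof -
  obtain ks where ks: "set ks = dom p" using finite_list[OF assms] by blast
  have "map_of (map (\<lambda>k. (k, the (p k))) ks) k = p k" for k
    using ks by (cases "p k") (auto simp: map_of_map_restrict restrict_map_def dom_def)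
  then have "map_of (map (\<lambda>k. (k, the (p k))) ks) = p" by blast
  then show ?thesis by blast
qed

lemma surj_list_decode_map:
  assumes "surj f"
  shows "\<exists>n. map f (list_decode n) = xs"
proof -
  have "map f (list_decode (list_encode (map (inv f) xs))) = xs"
    using assms by (simp add: surj_f_inv_f comp_def)
  then show ?thesis by blast
qed

lemma pattern_of_onto:
  assumes "finite (dom p)"
  shows "\<exists>n. pattern_of n = p"
proof -
  have "\<exists>n. pattern_entry_of n = y" for y
  proof -
    obtain n where n: "map int_decode (list_decode n) = fst y"
      using surj_list_decode_map[OF surj_int_decode] by blast
    have "pattern_entry_of (prod_encode (n, snd y)) = y"
      using n by (simp add: pattern_entry_of_def)
    then show ?thesis by blast
  qed
  then have surj: "surj pattern_entry_of" unfolding surj_def by metis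
  obtain xs where xs: "map_of xs = p" using finite_map_as_map_of[OF assms] by blast
  obtain n where "map pattern_entry_of (list_decode n) = xs"
    using surj_list_decode_map[OF surj] by blast
  then show ?thesis using xs unfolding pattern_of_def by blast
qed

lemma tm_of_onto:
  assumes "finite (dom M)"
  shows "\<exists>n. tm_of n = M"
proof -
  have "\<exists>n. transition_of n = y" for y
  proof -
    obtain k q a m where y: "y = (k, (q, a, m))" by (metis prod.exhaust)
    obtain j where j: "move_of j = m"
    proof (cases m)
      case MoveLeft
      then show ?thesis using that[of 0] by (simp add: move_of_def)
    next
      case Stay
      then show ?thesis using that[of 1] by (simp add: move_of_def)
    next
      case MoveRight
      then show ?thesis using that[of 2] by (simp add: move_of_def)
    qed
    have "transition_of (prod_encode (prod_encode k, prod_encode (q, prod_encode (a, j)))) = y"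
      using y j by (simp add: transition_of_def)
    then show ?thesis by blast
  qed
  then have surj: "surj transition_of" unfolding surj_def by metis
  obtain xs where xs: "map_of xs = M" using finite_map_as_map_of[OF assms] by blast
  obtain n where "map transition_of (list_decode n) = xs"
    using surj_list_decode_map[OF surj] by blast
  then show ?thesis using xs unfolding tm_of_def by blast
qed

lemma finite_dom_tm_of: "finite (dom (tm_of n))"
  by (simp add: tm_of_def finite_dom_map_of)

definition language_computable :: "nat \<Rightarrow> configuration set \<Rightarrow> bool" where
  "language_computable d Y \<longleftrightarrow> decidable {n. pattern_of n \<in> language d Y}"

text \<open>The effective subshift over the alphabet \<open>A\<close> whose forbidden patterns are enumerated by
  \<open>M\<close>.  Outputs that do not code a pattern over \<open>A\<close> are ignored, so every
  finite alphabet together with any machine is a legitimate input.\<close>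

definition effective_subshift :: "nat \<Rightarrow> nat set \<Rightarrow> tm \<Rightarrow> configuration set" where
  "effective_subshift d A M = subshift d A (pattern_of ` tm_enumerates M \<inter> patterns d A)"

text \<open>An instance codes a pair of an alphabet and a machine; \<open>set_decode\<close> is a bijection from
  the natural numbers to their finite subsets.\<close>

definition equality_problem :: "nat \<Rightarrow> configuration set \<Rightarrow> nat set" where
  "equality_problem d Y =
     {n. case prod_decode n of (a, m) \<Rightarrow> effective_subshift d (set_decode a) (tm_of m) = Y}"

end

theory Submission
  imports Defs
begin

text \<open>
  Membership: for an instance with subshift \<open>X\<close>, compactness of the space of colourings makes
  \<open>X \<subseteq> Y\<close> a \<open>\<Sigma>\<close> condition, because \<open>Y\<close> is of finite type, and \<open>Y \<subseteq> X\<close> fails iff \<open>Y\<close> uses a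
  letter that is missing, or an enumerated pattern is found in the computable language of \<open>Y\<close>.

  Hardness: to reduce \<open>U - V\<close>, add a new letter to the alphabet of \<open>Y\<close>, enumerate the forbidden
  patterns of \<open>Y\<close>, forbid the new letter once the input shows up in \<open>U\<close>, and forbid the empty
  pattern once it shows up in \<open>V\<close>.

  On the side of computability, primitive recursive functions, on numbers that code pairs, are run by
  counter programs, whose registers are the tracks of a Turing machine tape.  They suffice, since
  a nonempty \<open>\<Sigma>\<close> set is the range of a total function, and since a bounded simulation of Turing
  machines is primitive recursive.
\<close>

section \<open>Counter programs on Turing machines\<close>

text \<open>The obstacle on the hardness side is uniformity: the reduction has to compute the number
  of a machine from its input \<open>n\<close>, so it is not enough that a suitable machine exists
  for each \<open>n\<close>. Hence one fixed program is compiled once, and a computable prologue of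
  transitions writes \<open>n\<close> beside the machine's own input. Such a machine halts on every
  input, so it must output something even when nothing new has been found; a pattern with a letter
  outside the alphabet serves as this void output. On the membership side,
  \<open>X \<subseteq> Y\<close> quantifies over all configurations. Since \<open>X\<close> is
  closed under translation and \<open>Y\<close> has finitely many rules, it suffices to test the
  rules at the origin, and a colouring passes or drops out on a finite prefix; compactness turns
  these prefixes into one common bound. For \<open>Y \<subseteq> X\<close> the question whether a
  pattern occurs in \<open>Y\<close> is global, and the computability of the language answers it.
  Nonemptiness of \<open>Y\<close> is what lets the empty pattern destroy the equality.\<close>

datatype prog = Inc nat | Dec nat | Seq prog prog | Cond nat prog prog | While nat prog

text \<open>\<open>Dec\<close> has no rule at 0, where the compiled code would leave the head off
  position 0; every use below is guarded by a test.\<close>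

inductive exec :: "prog \<Rightarrow> (nat \<Rightarrow> nat) \<Rightarrow> (nat \<Rightarrow> nat) \<Rightarrow> bool" where
  exec_Inc: "exec (Inc r) s (s(r := Suc (s r)))"
| exec_Dec: "s r \<noteq> 0 \<Longrightarrow> exec (Dec r) s (s(r := s r - 1))"
| exec_Seq: "exec p s s' \<Longrightarrow> exec q s' s'' \<Longrightarrow> exec (Seq p q) s s''"
| exec_CondT: "s r \<noteq> 0 \<Longrightarrow> exec p s s' \<Longrightarrow> exec (Cond r p q) s s'"
| exec_CondF: "s r = 0 \<Longrightarrow> exec q s s' \<Longrightarrow> exec (Cond r p q) s s'"
| exec_WhileF: "s r = 0 \<Longrightarrow> exec (While r p) s s"
| exec_WhileT: "s r \<noteq> 0 \<Longrightarrow> exec p s s' \<Longrightarrow> exec (While r p) s' s'' \<Longrightarrow> exec (While r p) s s''"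

fun regs :: "prog \<Rightarrow> nat set" where
  "regs (Inc r) = {r}"
| "regs (Dec r) = {r}"
| "regs (Seq p q) = regs p \<union> regs q"
| "regs (Cond r p q) = insert r (regs p \<union> regs q)"
| "regs (While r p) = insert r (regs p)"

lemma finite_regs: "finite (regs p)"
  by (induction p) auto

text \<open>\<open>Inc\<close> sweeps out and back, \<open>Dec\<close> has a further state that
  erases the last mark, and \<open>Cond\<close> and \<open>While\<close> add one state for the test
  and one for a jump.\<close>

fun num_states :: "prog \<Rightarrow> nat" where
  "num_states (Inc r) = 2"
| "num_states (Dec r) = 3"
| "num_states (Seq p q) = num_states p + num_states q"
| "num_states (Cond r p q) = num_states p + num_states q + 2"
| "num_states (While r p) = num_states p + 2"

text \<open>A tape symbol codes the set of tracks that are marked in its cell; bounding the number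
  of tracks keeps the transition tables finite.\<close>

definition symbols :: "nat \<Rightarrow> nat set" where
  "symbols K = {c. set_decode c \<subseteq> {..<K}}"

lemma finite_symbols: "finite (symbols K)"
proof -
  have "symbols K \<subseteq> set_encode ` Pow {..<K}"
    unfolding symbols_def by (force intro: image_eqI[where x = "set_decode _"])
  then show ?thesis by (rule finite_subset) simp
qed

definition state_table :: "nat \<Rightarrow> nat \<Rightarrow> (nat \<Rightarrow> nat \<times> nat \<times> move) \<Rightarrow> tm" where
  "state_table K q f = (\<lambda>(q', c). if q' = q \<and> c \<in> symbols K then Some (f c) else None)"

text \<open>The program occupies the states from \<open>a\<close> up to its exit state \<open>a + num_states p\<close>, and
  runs from head position 0 back to head position 0.\<close>

fun compile :: "nat \<Rightarrow> prog \<Rightarrow> nat \<Rightarrow> tm" where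
  "compile K (Inc r) a =
     state_table K a (\<lambda>c. if r \<in> set_decode c then (a, c, MoveRight)
       else (a + 1, set_encode (insert r (set_decode c)), MoveLeft)) ++
     state_table K (a + 1) (\<lambda>c. if r \<in> set_decode c then (a + 1, c, MoveLeft) else (a + 2, c, MoveRight))"
| "compile K (Dec r) a =
     state_table K a (\<lambda>c. if r \<in> set_decode c then (a, c, MoveRight) else (a + 1, c, MoveLeft)) ++
     (state_table K (a + 1) (\<lambda>c. (a + 2, set_encode (set_decode c - {r}), MoveLeft)) ++
     state_table K (a + 2) (\<lambda>c. if r \<in> set_decode c then (a + 2, c, MoveLeft) else (a + 3, c, MoveRight)))"
| "compile K (Seq p q) a = compile K p a ++ compile K q (a + num_states p)"
| "compile K (Cond r p q) a =
     state_table K a (\<lambda>c. (if r \<in> set_decode c then a + 1 else a + num_states p + 2, c, Stay)) ++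
     (compile K p (a + 1) ++
     (state_table K (a + num_states p + 1) (\<lambda>c. (a + num_states p + num_states q + 2, c, Stay)) ++
     compile K q (a + num_states p + 2)))"
| "compile K (While r p) a =
     state_table K a (\<lambda>c. (if r \<in> set_decode c then a + 1 else a + num_states p + 2, c, Stay)) ++
     (compile K p (a + 1) ++
     state_table K (a + num_states p + 1) (\<lambda>c. (a, c, Stay)))"

lemma state_table_Some_iff:
  "state_table K q f (x, c) = Some y \<longleftrightarrow> x = q \<and> c \<in> symbols K \<and> y = f c"
  by (auto simp: state_table_def)

lemma compile_SomeD:
  "compile K p a (x, c) = Some y \<Longrightarrow> a \<le> x \<and> x < a + num_states p \<and> c \<in> symbols K"
proof (induction p arbitrary: a)
  case (Seq p q)
  from Seq.prems show ?case using Seq.IH(1)[of a] Seq.IH(2)[of "a + num_states p"]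
    by (auto simp: map_add_Some_iff)
next
  case (Cond r p q)
  from Cond.prems show ?case using Cond.IH(1)[of "a + 1"] Cond.IH(2)[of "a + num_states p + 2"]
    by (auto simp: map_add_Some_iff state_table_Some_iff)
next
  case (While r p)
  from While.prems show ?case using While.IH[of "a + 1"]
    by (auto simp: map_add_Some_iff state_table_Some_iff)
qed (auto simp: map_add_Some_iff state_table_Some_iff)

lemma finite_dom_compile: "finite (dom (compile K p a))"
proof (rule finite_subset)
  show "dom (compile K p a) \<subseteq> {a..<a + num_states p} \<times> symbols K"
    using compile_SomeD[of K p a] by fastforce
qed (simp add: finite_symbols)

definition state_range :: "tm \<Rightarrow> nat \<Rightarrow> nat \<Rightarrow> bool" where
  "state_range f l h \<longleftrightarrow> (\<forall>x c. f (x, c) \<noteq> None \<longrightarrow> l \<le> x \<and> x < h)"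

lemma state_range_compile: "state_range (compile K p a) a (a + num_states p)"
  using compile_SomeD[of K p a] by (auto simp: state_range_def)

lemma state_range_table: "state_range (state_table K q f) q (Suc q)"
  by (auto simp: state_range_def state_table_Some_iff)

lemma state_range_add:
  assumes "state_range f l m" "state_range g m' h" "m \<le> m'" "l \<le> m'" "m \<le> h"
  shows "state_range (f ++ g) l h"
  using assms unfolding state_range_def by (auto simp: map_add_Some_iff) (fastforce+)

lemma map_add_leD2: "f ++ g \<subseteq>\<^sub>m h \<Longrightarrow> g \<subseteq>\<^sub>m h"
  using map_le_map_add map_le_trans by blast

text \<open>In \<open>f ++ g\<close> the right table overrides the left one, so \<open>f\<close>
  survives only because the two intervals of states do not meet.\<close>

lemma map_add_leD1:
  assumes "f ++ g \<subseteq>\<^sub>m h" "state_range f l m" "state_range g m' k" "m \<le> m'"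
  shows "f \<subseteq>\<^sub>m h"
proof -
  have "dom f \<inter> dom g = {}"
  proof (rule ccontr)
    assume "dom f \<inter> dom g \<noteq> {}"
    then obtain x c where "f (x, c) \<noteq> None" "g (x, c) \<noteq> None" unfolding dom_def by fast
    then show False using assms(2-4) unfolding state_range_def by (meson leD le_less_trans less_le_trans)
  qed
  then show ?thesis using assms(1) map_add_comm map_le_map_add map_le_trans by metis
qed

lemmas state_ranges = state_range_compile state_range_table state_range_add

section \<open>Runs of machines and correctness of the compiler\<close>

definition steps :: "tm \<Rightarrow> tm_config \<Rightarrow> tm_config \<Rightarrow> bool" where
  "steps M = (\<lambda>c c'. tm_step M c = Some c')\<^sup>*\<^sup>*"

lemma steps_refl [simp]: "steps M c c"
  by (simp add: steps_def)

lemma steps_trans [trans]: "steps M c d \<Longrightarrow> steps M d e \<Longrightarrow> steps M c e"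
  unfolding steps_def by (rule rtranclp_trans)

lemma steps_step:
  assumes "M (q, t h) = Some (q', a, m)" "steps M (q', h + shift_of m, t(h := a)) c"
  shows "steps M (q, h, t) c"
  unfolding steps_def
  by (rule converse_rtranclp_into_rtranclp[OF _ assms(2)[unfolded steps_def]]) (simp add: assms(1))

lemma steps_right:
  assumes "\<And>j. h \<le> j \<Longrightarrow> j < h + int n \<Longrightarrow> M (q, t j) = Some (q, t j, MoveRight)"
  shows "steps M (q, h, t) (q, h + int n, t)"
  using assms
proof (induction n arbitrary: h)
  case (Suc n)
  have "steps M (q, h + 1, t) (q, (h + 1) + int n, t)"
    by (rule Suc.IH) (use Suc.prems in auto)
  then show ?case
    by - (rule steps_step, rule Suc.prems, auto simp: algebra_simps)
qed simp

lemma steps_left: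
  assumes "\<And>j. h - int n < j \<Longrightarrow> j \<le> h \<Longrightarrow> M (q, t j) = Some (q, t j, MoveLeft)"
  shows "steps M (q, h, t) (q, h - int n, t)"
  using assms
proof (induction n arbitrary: h)
  case (Suc n)
  have "steps M (q, h - 1, t) (q, (h - 1) - int n, t)"
    by (rule Suc.IH) (use Suc.prems in auto)
  then show ?case
    by - (rule steps_step, rule Suc.prems, auto simp: algebra_simps)
qed simp

text \<open>Bit \<open>r\<close> of the symbol in cell \<open>j\<close> tells whether \<open>j < s r\<close>.  Hence a unary input, or output, is
  the tape on which only register 0 is nonzero.\<close>

definition tape :: "nat \<Rightarrow> (nat \<Rightarrow> nat) \<Rightarrow> int \<Rightarrow> nat" where
  "tape K s j = set_encode {r. r < K \<and> 0 \<le> j \<and> j < int (s r)}"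

lemma set_decode_tape: "set_decode (tape K s j) = {r. r < K \<and> 0 \<le> j \<and> j < int (s r)}"
  by (simp add: tape_def)

lemma tape_symbols: "tape K s j \<in> symbols K"
  by (auto simp: symbols_def set_decode_tape)

lemma state_table_tape:
  assumes "state_table K q f \<subseteq>\<^sub>m M"
  shows "M (q, tape K s j) = Some (f (tape K s j))"
proof -
  have *: "state_table K q f (q, tape K s j) = Some (f (tape K s j))"
    by (simp add: state_table_Some_iff tape_symbols)
  then have "(q, tape K s j) \<in> dom (state_table K q f)"
    by (rule domI)
  then have "state_table K q f (q, tape K s j) = M (q, tape K s j)"
    using assms by (auto simp only: map_le_def)
  then show ?thesis
    using * by (rule subst)
qed

lemma set_decode_eqD: "set_decode a = set_decode b \<Longrightarrow> a = b"
  by (metis set_decode_inverse)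

lemma tape_Suc:
  assumes "r < K"
  shows "(tape K s)(int (s r) := set_encode (insert r (set_decode (tape K s (int (s r))))))
    = tape K (s(r := Suc (s r)))"
  using assms
  by (intro ext set_decode_eqD) (auto simp: set_decode_tape simp del: set_encode_insert)

lemma tape_pred:
  assumes "r < K" "s r \<noteq> 0"
  shows "(tape K s)(int (s r) - 1 := set_encode (set_decode (tape K s (int (s r) - 1)) - {r}))
    = tape K (s(r := s r - 1))"
  using assms
  by (intro ext set_decode_eqD) (auto simp: set_decode_tape simp del: set_encode_insert)

text \<open>Cell -1 never carries a mark, so the head recognises the left end by overshooting to it
  and stepping back.\<close>

lemma steps_Inc:
  assumes "r < K" "compile K (Inc r) a \<subseteq>\<^sub>m M"
  shows "steps M (a, 0, tape K s) (a + 2, 0, tape K (s(r := Suc (s r))))"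
proof -
  let ?s = "s(r := Suc (s r))"
  note M = assms(2)[unfolded compile.simps]
  note M1 = map_add_leD1[OF M state_range_table state_range_table, simplified]
    and M2 = map_add_leD2[OF M]
  have M1: "M (a, tape K s j) = Some (if 0 \<le> j \<and> j < int (s r) then (a, tape K s j, MoveRight)
       else (Suc a, set_encode (insert r (set_decode (tape K s j))), MoveLeft))" for s j
    by (subst state_table_tape[OF M1]) (auto simp: set_decode_tape assms)
  have M2: "M (Suc a, tape K s j) = Some (if 0 \<le> j \<and> j < int (s r) then (Suc a, tape K s j, MoveLeft)
       else (a + 2, tape K s j, MoveRight))" for s j
    by (subst state_table_tape[OF M2[simplified]]) (auto simp: set_decode_tape assms)
  have "steps M (a, 0, tape K s) (a, 0 + int (s r), tape K s)"
    by (rule steps_right) (simp add: M1)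
  also have "steps M \<dots> (Suc a, int (s r) - 1, tape K ?s)"
    by (rule steps_step, subst M1) (auto simp: tape_Suc[OF assms(1)] simp del: set_encode_insert)
  also have "steps M (Suc a, int (s r) - 1, tape K ?s) (Suc a, (int (s r) - 1) - int (s r), tape K ?s)"
    by (rule steps_left) (auto simp: M2)
  also have "steps M \<dots> (a + 2, 0, tape K ?s)"
    by (rule steps_step, subst M2) auto
  finally show ?thesis .
qed

lemma steps_Dec:
  assumes "r < K" "compile K (Dec r) a \<subseteq>\<^sub>m M" "s r \<noteq> 0"
  shows "steps M (a, 0, tape K s) (a + 3, 0, tape K (s(r := s r - 1)))"
proof -
  let ?s = "s(r := s r - 1)"
  note M = assms(2)[unfolded compile.simps]
  note M1 = map_add_leD1[OF M state_range_table state_range_add[OF state_range_table state_range_table], simplified]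
    and M2 = map_add_leD1[OF map_add_leD2[OF M] state_range_table state_range_table, simplified]
    and M3 = map_add_leD2[OF map_add_leD2[OF M]]
  have M1: "M (a, tape K s j) = Some (if 0 \<le> j \<and> j < int (s r) then (a, tape K s j, MoveRight)
       else (a + 1, tape K s j, MoveLeft))" for s j
    by (subst state_table_tape[OF M1]) (auto simp: set_decode_tape assms)
  have M2: "M (a + 1, tape K s j) = Some (a + 2, set_encode (set_decode (tape K s j) - {r}), MoveLeft)" for s j
    using state_table_tape[OF M2] by simp
  have M3: "M (a + 2, tape K s j) = Some (if 0 \<le> j \<and> j < int (s r) then (a + 2, tape K s j, MoveLeft)
       else (a + 3, tape K s j, MoveRight))" for s j
    by (subst state_table_tape[OF M3]) (auto simp: set_decode_tape assms)
  have "steps M (a, 0, tape K s) (a, 0 + int (s r), tape K s)"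
    by (rule steps_right) (simp add: M1)
  also have "steps M \<dots> (a + 1, int (s r) - 1, tape K s)"
    by (rule steps_step, subst M1) auto
  also have "steps M \<dots> (a + 2, int (s r) - 1 - 1, tape K ?s)"
    by (rule steps_step, rule M2) (subst tape_pred, use assms in simp_all)
  also have "steps M \<dots> (a + 2, (int (s r) - 1 - 1) - int (s r - 1), tape K ?s)"
    using assms(3) by (intro steps_left, subst M3) auto
  also have "steps M \<dots> (a + 3, 0, tape K ?s)"
    by (rule steps_step, subst M3) (use assms(3) in auto)
  finally show ?thesis .
qed

lemma compile_Cond_le:
  assumes "compile K (Cond r p q) a \<subseteq>\<^sub>m M"
  shows "state_table K a (\<lambda>c. (if r \<in> set_decode c then a + 1 else a + num_states p + 2, c, Stay)) \<subseteq>\<^sub>m M"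
    and "compile K p (a + 1) \<subseteq>\<^sub>m M"
    and "state_table K (a + num_states p + 1)
      (\<lambda>c. (a + num_states p + num_states q + 2, c, Stay)) \<subseteq>\<^sub>m M"
    and "compile K q (a + num_states p + 2) \<subseteq>\<^sub>m M"
proof -
  note M1 = assms[unfolded compile.simps]
  note M2 = map_add_leD2[OF M1]
  note M3 = map_add_leD2[OF M2]
  show "state_table K a (\<lambda>c. (if r \<in> set_decode c then a + 1 else a + num_states p + 2, c, Stay)) \<subseteq>\<^sub>m M"
    by (rule map_add_leD1[OF M1], (rule state_ranges)+) simp_all
  show "compile K p (a + 1) \<subseteq>\<^sub>m M"
    by (rule map_add_leD1[OF M2], (rule state_ranges)+) simp_all
  show "state_table K (a + num_states p + 1)
      (\<lambda>c. (a + num_states p + num_states q + 2, c, Stay)) \<subseteq>\<^sub>m M"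
    by (rule map_add_leD1[OF M3], (rule state_ranges)+) simp_all
  show "compile K q (a + num_states p + 2) \<subseteq>\<^sub>m M"
    by (rule map_add_leD2[OF M3])
qed

lemma compile_While_le:
  assumes "compile K (While r p) a \<subseteq>\<^sub>m M"
  shows "state_table K a (\<lambda>c. (if r \<in> set_decode c then a + 1 else a + num_states p + 2, c, Stay)) \<subseteq>\<^sub>m M"
    and "compile K p (a + 1) \<subseteq>\<^sub>m M"
    and "state_table K (a + num_states p + 1) (\<lambda>c. (a, c, Stay)) \<subseteq>\<^sub>m M"
proof -
  note M1 = assms[unfolded compile.simps]
  note M2 = map_add_leD2[OF M1]
  show "state_table K a (\<lambda>c. (if r \<in> set_decode c then a + 1 else a + num_states p + 2, c, Stay)) \<subseteq>\<^sub>m M"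
    by (rule map_add_leD1[OF M1], (rule state_ranges)+) simp_all
  show "compile K p (a + 1) \<subseteq>\<^sub>m M"
    by (rule map_add_leD1[OF M2], (rule state_ranges)+) simp_all
  show "state_table K (a + num_states p + 1) (\<lambda>c. (a, c, Stay)) \<subseteq>\<^sub>m M"
    by (rule map_add_leD2[OF M2])
qed

text \<open>Allowing any machine that extends the compiled table serves the induction, where
  subprograms run inside larger ones, and later lets a program run inside a machine with a
  prologue.\<close>

lemma steps_compile:
  assumes "exec p s s'" "regs p \<subseteq> {..<K}" "compile K p a \<subseteq>\<^sub>m M"
  shows "steps M (a, 0, tape K s) (a + num_states p, 0, tape K s')"
  using assms
proof (induction arbitrary: a rule: exec.induct)
  case (exec_Inc r s)
  then show ?case using steps_Inc[of r K a M s] by (simp del: compile.simps fun_upd_apply)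
next
  case (exec_Dec s r)
  then show ?case using steps_Dec[of r K a M s] by (simp del: compile.simps fun_upd_apply)
next
  case (exec_Seq p s s' q s'')
  note le = exec_Seq.prems(2)[unfolded compile.simps]
  note M = map_add_leD1[OF le state_range_compile state_range_compile order_refl] map_add_leD2[OF le]
  show ?case
    using steps_trans[OF exec_Seq.IH(1)[OF _ M(1)] exec_Seq.IH(2)[OF _ M(2)]] exec_Seq.prems(1)
    by (simp add: add.assoc)
next
  case (exec_CondT s r p s' q)
  note M = compile_Cond_le[OF exec_CondT.prems(2)]
  have "steps M (a, 0, tape K s) (a + 1, 0, tape K s)"
    by (rule steps_step, subst state_table_tape[OF M(1)]) (use exec_CondT in \<open>auto simp: set_decode_tape\<close>)
  also have "steps M \<dots> (a + num_states p + 1, 0, tape K s')"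
    using exec_CondT.IH[OF _ M(2)] exec_CondT.prems by simp
  also have "steps M \<dots> (a + num_states p + num_states q + 2, 0, tape K s')"
    by (rule steps_step, subst state_table_tape[OF M(3)]) auto
  finally show ?case by (simp add: algebra_simps)
next
  case (exec_CondF s r q s' p)
  note M = compile_Cond_le[OF exec_CondF.prems(2)]
  have "steps M (a, 0, tape K s) (a + num_states p + 2, 0, tape K s)"
    by (rule steps_step, subst state_table_tape[OF M(1)]) (use exec_CondF in \<open>auto simp: set_decode_tape\<close>)
  also have "steps M \<dots> (a + num_states p + 2 + num_states q, 0, tape K s')"
    using exec_CondF.prems by (intro exec_CondF.IH M(4)) auto
  finally show ?case by (simp add: algebra_simps)
next
  case (exec_WhileF s r p)
  note M = compile_While_le[OF exec_WhileF.prems(2)]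
  have "steps M (a, 0, tape K s) (a + num_states p + 2, 0, tape K s)"
    by (rule steps_step, subst state_table_tape[OF M(1)]) (use exec_WhileF in \<open>auto simp: set_decode_tape\<close>)
  then show ?case by (simp add: algebra_simps)
next
  case (exec_WhileT s r p s' s'')
  note M = compile_While_le[OF exec_WhileT.prems(2)]
  have "steps M (a, 0, tape K s) (a + 1, 0, tape K s)"
    by (rule steps_step, subst state_table_tape[OF M(1)]) (use exec_WhileT in \<open>auto simp: set_decode_tape\<close>)
  also have "steps M \<dots> (a + num_states p + 1, 0, tape K s')"
    using exec_WhileT.IH(1)[OF _ M(2)] exec_WhileT.prems by simp
  also have "steps M \<dots> (a, 0, tape K s')"
    by (rule steps_step, subst state_table_tape[OF M(3)]) auto
  also have "steps M \<dots> (a + num_states (While r p), 0, tape K s'')"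
    using exec_WhileT.prems by (intro exec_WhileT.IH(2)) auto
  finally show ?case .
qed

lemma tape_unary: "0 < K \<Longrightarrow> tape K ((\<lambda>_. 0)(0 := n)) j = (if 0 \<le> j \<and> j < int n then 1 else 0)"
proof -
  assume "0 < K"
  then have "{r. r < K \<and> 0 \<le> j \<and> j < int (((\<lambda>_. 0)(0 := n)) r)} = (if 0 \<le> j \<and> j < int n then {0} else {})"
    by auto
  then show ?thesis
    by (simp add: tape_def del: fun_upd_apply)
qed

lemma compile_final: "compile K p a (a + num_states p, c) = None"
  using compile_SomeD[of K p a "a + num_states p" c] by (cases "compile K p a (a + num_states p, c)") auto

lemma tm_resultI:
  assumes "steps M (tm_init n) (q, 0, tape K ((\<lambda>_. 0)(0 := k)))" "0 < K"
    and "M (q, if k = 0 then 0 else 1) = None"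
  shows "tm_result M n k"
proof -
  have "tm_step M (q, 0, tape K ((\<lambda>_. 0)(0 := k))) = None"
    using assms(2,3) by (auto simp: tape_unary)
  then show ?thesis
    using assms(1,2) unfolding tm_result_def steps_def[symmetric]
    by (intro exI[of _ q] exI[of _ 0] exI[of _ "tape K ((\<lambda>_. 0)(0 := k))"]) (auto simp: tape_unary)
qed

lemma computable_exec:
  assumes "\<And>n. exec p ((\<lambda>_. 0)(0 := n)) ((\<lambda>_. 0)(0 := f n))"
  shows "computable f"
proof -
  obtain K where K: "insert 0 (regs p) \<subseteq> {..<K}"
    using finite_nat_set_iff_bounded[of "insert 0 (regs p)"] finite_regs by auto
  have "tm_result (compile K p 0) n (f n)" for n
  proof (rule tm_resultI)
    have "tm_init n = (0, 0, tape K ((\<lambda>_. 0)(0 := n)))"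
      using K by (auto simp: tm_init_def tape_unary simp del: fun_upd_apply)
    then show "steps (compile K p 0) (tm_init n) (0 + num_states p, 0, tape K ((\<lambda>_. 0)(0 := f n)))"
      using steps_compile[where a = 0, OF assms _ map_le_refl] K by (simp del: fun_upd_apply)
  qed (use K compile_final[of K p 0] in auto)
  then show ?thesis
    unfolding computable_def using finite_dom_compile by blast
qed

text \<open>\<open>\<sigma> n\<close> is the store at the test when \<open>n\<close> rounds remain;
  the assumption on \<open>p\<close> starts after the decrement, hence from
  \<open>\<sigma> (Suc n)\<close> with \<open>r\<close> already lowered.\<close>

lemma exec_loop:
  assumes "\<And>n. \<sigma> n r = n" "\<And>n. n < N \<Longrightarrow> exec p ((\<sigma> (Suc n))(r := n)) (\<sigma> n)"
  shows "exec (While r (Seq (Dec r) p)) (\<sigma> N) (\<sigma> 0)"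
proof -
  have "n \<le> N \<Longrightarrow> exec (While r (Seq (Dec r) p)) (\<sigma> n) (\<sigma> 0)" for n
  proof (induction n)
    case 0
    show ?case by (rule exec_WhileF) (rule assms(1))
  next
    case (Suc n)
    have "exec (Dec r) (\<sigma> (Suc n)) ((\<sigma> (Suc n))(r := n))"
      using exec_Dec[of "\<sigma> (Suc n)" r] assms(1)[of "Suc n"] by simp
    moreover have "exec p ((\<sigma> (Suc n))(r := n)) (\<sigma> n)"
      using Suc.prems by (intro assms(2)) simp
    ultimately have "exec (Seq (Dec r) p) (\<sigma> (Suc n)) (\<sigma> n)"
      by (rule exec_Seq)
    then show ?case
      using Suc assms(1)[of "Suc n"] by (intro exec_WhileT[of "\<sigma> (Suc n)" r]) auto
  qed
  then show ?thesis by simp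
qed

lemma exec_loop':
  assumes "s = \<sigma> N" "s' = \<sigma> 0" "\<And>n. \<sigma> n r = n"
    and "\<And>n. n < N \<Longrightarrow> exec p ((\<sigma> (Suc n))(r := n)) (\<sigma> n)"
  shows "exec (While r (Seq (Dec r) p)) s s'"
  using exec_loop[OF assms(3,4)] assms(1,2) by simp

lemma exec_Inc': "s' = s(r := Suc (s r)) \<Longrightarrow> exec (Inc r) s s'"
  by (simp add: exec_Inc)

section \<open>Register programs for copying and pairing\<close>

definition clear :: "nat \<Rightarrow> prog" where
  "clear r = While r (Dec r)"

lemma exec_clear: "s' = s(r := 0) \<Longrightarrow> exec (clear r) s s'"
  unfolding clear_def
proof (induction "s r" arbitrary: s)
  case 0
  then show ?case using exec_WhileF[of s r] by (metis fun_upd_triv)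
next
  case (Suc n)
  have "exec (While r (Dec r)) (s(r := s r - 1)) s'"
    using Suc by (intro Suc.hyps(1)) auto
  then show ?case
    by - (rule exec_WhileT[OF _ exec_Dec], use Suc.hyps(2) in auto)
qed

definition move_reg :: "nat \<Rightarrow> nat \<Rightarrow> prog" where
  "move_reg r t = While r (Seq (Dec r) (Inc t))"

lemma exec_move_reg: "r \<noteq> t \<Longrightarrow> s' = s(r := 0, t := s t + s r) \<Longrightarrow> exec (move_reg r t) s s'"
  unfolding move_reg_def
  by (rule exec_loop'[where \<sigma> = "\<lambda>n. s(r := n, t := s t + (s r - n))" and N = "s r"])
    (auto intro!: exec_Inc' simp: fun_eq_iff)

text \<open>Reading a register destroys it, so a copy needs two targets.\<close>

definition spread_reg :: "nat \<Rightarrow> nat \<Rightarrow> nat \<Rightarrow> prog" where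
  "spread_reg r t u = While r (Seq (Dec r) (Seq (Inc t) (Inc u)))"

lemma exec_spread_reg:
  "distinct [r, t, u] \<Longrightarrow> s' = s(r := 0, t := s t + s r, u := s u + s r) \<Longrightarrow> exec (spread_reg r t u) s s'"
  unfolding spread_reg_def
  by (rule exec_loop'[where \<sigma> = "\<lambda>n. s(r := n, t := s t + (s r - n), u := s u + (s r - n))" and N = "s r"])
    (auto intro!: exec_Seq[OF exec_Inc exec_Inc'] simp: fun_eq_iff)

text \<open>The pairing is \<open>triangle (m + n) + m\<close>. The triangle number is accumulated
  in register \<open>b + 2\<close>, by adding \<open>k + 1\<close> for each
  \<open>k < m + n\<close>.\<close>

definition pair_prog :: "nat \<Rightarrow> prog" where
  "pair_prog b = Seq (spread_reg b (b + 1) (b + 2))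
     (Seq (While (b + 1) (Seq (Dec (b + 1))
        (Seq (Inc (b + 2)) (Seq (spread_reg (b + 1) b (b + 2)) (move_reg b (b + 1))))))
     (move_reg (b + 2) b))"

lemma exec_pair_prog:
  assumes "s (b + 2) = 0" "s' = s(b := prod_encode (s b, s (b + 1)), b + 1 := 0)"
  shows "exec (pair_prog b) s s'"
  unfolding pair_prog_def
proof (intro exec_Seq)
  let ?m = "s b" and ?n = "s (b + 1)"
  let ?\<sigma> = "\<lambda>k. s(b := 0, b + 1 := k, b + 2 := ?m + (triangle (?m + ?n) - triangle k))"
  show "exec (spread_reg b (b + 1) (b + 2)) s (?\<sigma> (?m + ?n))"
    using assms by (intro exec_spread_reg) (auto simp: fun_eq_iff)
  show "exec (While (b + 1) (Seq (Dec (b + 1))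
        (Seq (Inc (b + 2)) (Seq (spread_reg (b + 1) b (b + 2)) (move_reg b (b + 1))))))
        (?\<sigma> (?m + ?n)) (?\<sigma> 0)"
  proof (rule exec_loop)
    fix k assume k: "k < ?m + ?n"
    have "triangle (Suc k) \<le> triangle (?m + ?n)"
      using k by (metis Suc_leI add_diff_inverse_nat less_irrefl_nat not_le le_Suc_ex triangle_Suc lift_Suc_mono_le le_add1)
    then have t: "triangle (?m + ?n) - triangle k = triangle (?m + ?n) - triangle (Suc k) + Suc k"
      by simp
    show "exec (Seq (Inc (b + 2)) (Seq (spread_reg (b + 1) b (b + 2)) (move_reg b (b + 1))))
       ((?\<sigma> (Suc k))(b + 1 := k)) (?\<sigma> k)"
      by (rule exec_Seq[OF exec_Inc], rule exec_Seq[OF exec_spread_reg[OF _ refl]], simp, rule exec_move_reg)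
        (use t in \<open>auto simp: fun_eq_iff simp del: triangle_Suc\<close>)
  qed simp
  show "exec (move_reg (b + 2) b) (?\<sigma> 0) s'"
    using assms by (intro exec_move_reg) (auto simp: fun_eq_iff prod_encode_def)
qed

text \<open>The enumeration of all pairs is walked from \<open>(0, 0)\<close>, one step per unit of
  the code: along a diagonal, or from its end to the start of the next one.\<close>

definition unpair_prog :: "nat \<Rightarrow> prog" where
  "unpair_prog b = Seq (While b (Seq (Dec b)
       (Cond (b + 2) (Seq (Dec (b + 2)) (Inc (b + 1))) (Seq (move_reg (b + 1) (b + 2)) (Inc (b + 2))))))
     (Seq (move_reg (b + 1) b) (move_reg (b + 2) (b + 1)))"

lemma prod_decode_Suc:
  "prod_decode (Suc z) = (case prod_decode z of (m, n) \<Rightarrow> if n = 0 then (0, Suc m) else (Suc m, n - 1))"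
proof -
  obtain m n where "prod_decode z = (m, n)" by fastforce
  then have "z = prod_encode (m, n)" by (metis prod_decode_inverse)
  moreover have "Suc (prod_encode (m, 0)) = prod_encode (0, Suc m)" by (simp add: prod_encode_def)
  moreover have "n \<noteq> 0 \<Longrightarrow> Suc (prod_encode (m, n)) = prod_encode (Suc m, n - 1)" by (cases n) (simp_all add: prod_encode_def)
  ultimately show ?thesis by auto
qed

definition pfst :: "nat \<Rightarrow> nat" where "pfst n = fst (prod_decode n)"
definition psnd :: "nat \<Rightarrow> nat" where "psnd n = snd (prod_decode n)"

lemma pfst_encode [simp]: "pfst (prod_encode p) = fst p"
  and psnd_encode [simp]: "psnd (prod_encode p) = snd p"
  by (simp_all add: pfst_def psnd_def)

lemma prod_decode_eq: "prod_decode n = (pfst n, psnd n)"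
  by (simp add: pfst_def psnd_def)

lemma prod_encode_pfst_psnd [simp]: "prod_encode (pfst n, psnd n) = n"
  by (simp add: pfst_def psnd_def)

lemma pfst_0 [simp]: "pfst 0 = 0" and psnd_0 [simp]: "psnd 0 = 0"
  by (simp_all add: pfst_def psnd_def prod_decode_def prod_decode_aux.simps)

lemma exec_unpair_prog:
  assumes "s (b + 1) = 0" "s (b + 2) = 0" "s' = s(b := pfst (s b), b + 1 := psnd (s b))"
  shows "exec (unpair_prog b) s s'"
  unfolding unpair_prog_def
proof (intro exec_Seq)
  let ?z = "s b"
  let ?\<sigma> = "\<lambda>k. s(b := k, b + 1 := pfst (?z - k), b + 2 := psnd (?z - k))"
  have z: "s = ?\<sigma> ?z" using assms(1,2) by (auto simp: fun_eq_iff)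
  show "exec (While b (Seq (Dec b)
       (Cond (b + 2) (Seq (Dec (b + 2)) (Inc (b + 1))) (Seq (move_reg (b + 1) (b + 2)) (Inc (b + 2))))))
       s (?\<sigma> 0)"
  proof (rule exec_loop'[where \<sigma> = ?\<sigma> and N = ?z, OF z refl])
    fix k assume k: "k < ?z"
    let ?s = "(?\<sigma> (Suc k))(b := k)" and ?y = "?z - Suc k"
    have y: "?z - k = Suc ?y" using k by simp
    have f: "pfst (Suc ?y) = (if psnd ?y = 0 then 0 else Suc (pfst ?y))"
      "psnd (Suc ?y) = (if psnd ?y = 0 then Suc (pfst ?y) else psnd ?y - 1)"
      by (simp_all add: pfst_def psnd_def prod_decode_Suc split: prod.split)
    show "exec (Cond (b + 2) (Seq (Dec (b + 2)) (Inc (b + 1))) (Seq (move_reg (b + 1) (b + 2)) (Inc (b + 2))))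
      ?s (?\<sigma> k)"
    proof (cases "psnd ?y = 0")
      case True
      show ?thesis
        by (rule exec_CondF, simp add: True, rule exec_Seq[OF exec_move_reg[OF _ refl]], simp, rule exec_Inc')
          (auto simp: fun_eq_iff y f True)
    next
      case False
      show ?thesis
        by (rule exec_CondT, simp add: False, rule exec_Seq[OF exec_Dec], simp add: False, rule exec_Inc')
          (auto simp: fun_eq_iff y f False)
    qed
  qed simp
  show "exec (move_reg (b + 1) b) (?\<sigma> 0) ((?\<sigma> 0)(b + 1 := 0, b := pfst ?z))"
    by (rule exec_move_reg) (auto simp: fun_eq_iff)
  show "exec (move_reg (b + 2) (b + 1)) ((?\<sigma> 0)(b + 1 := 0, b := pfst ?z)) s'"
    using assms by (intro exec_move_reg) (auto simp: fun_eq_iff)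
qed

text \<open>The program \<open>P b\<close> works in place on register \<open>b\<close> and takes the registers above \<open>b\<close> as scratch
  space, so that programs can be nested by shifting \<open>b\<close>.  Several arguments are passed as one number
  via \<open>prod_encode\<close>.\<close>

definition pr :: "(nat \<Rightarrow> nat) \<Rightarrow> bool" where
  "pr f \<longleftrightarrow> (\<exists>P. \<forall>b s. (\<forall>i>b. s i = 0) \<longrightarrow> exec (P b) s (s(b := f (s b))))"

lemma prI:
  assumes "\<And>b s. (\<And>i. b < i \<Longrightarrow> s i = 0) \<Longrightarrow> exec (P b) s (s(b := f (s b)))"
  shows "pr f"
  unfolding pr_def by (rule exI[of _ P]) (use assms in blast)

lemma prE:
  assumes "pr f"
  obtains P where "\<And>b s s'. (\<And>i. b < i \<Longrightarrow> s i = 0) \<Longrightarrow> s' = s(b := f (s b)) \<Longrightarrow> exec (P b) s s'"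
  using assms unfolding pr_def by blast

lemma pr_computable: "pr f \<Longrightarrow> computable f"
proof (erule prE)
  fix P assume P: "\<And>b s s'. (\<And>i. b < i \<Longrightarrow> s i = 0) \<Longrightarrow> s' = s(b := f (s b)) \<Longrightarrow> exec (P b) s s'"
  show "computable f"
    by (rule computable_exec[of "P 0"], rule P) auto
qed

lemma pr_comp: 
  assumes "pr f" "pr g"
  shows "pr (\<lambda>x. f (g x))"
proof -
  from assms(1) obtain P where P: "\<And>b s s'. (\<And>i. b < i \<Longrightarrow> s i = 0) \<Longrightarrow> s' = s(b := f (s b)) \<Longrightarrow> exec (P b) s s'"
    by (rule prE) blast
  from assms(2) obtain Q where Q: "\<And>b s s'. (\<And>i. b < i \<Longrightarrow> s i = 0) \<Longrightarrow> s' = s(b := g (s b)) \<Longrightarrow> exec (Q b) s s'"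
    by (rule prE) blast
  show ?thesis
    by (rule prI[where P = "\<lambda>b. Seq (Q b) (P b)"], rule exec_Seq[OF Q[OF _ refl]], simp, rule P) auto
qed

lemma pr_id: "pr (\<lambda>x. x)"
  \<comment> \<open>There is no empty program; moving one empty scratch register to another changes
    nothing.\<close>
  by (rule prI[where P = "\<lambda>b. move_reg (b + 1) (b + 2)"], rule exec_move_reg) (auto simp: fun_eq_iff)

lemma pr_zero: "pr (\<lambda>x. 0)"
  by (rule prI[where P = clear], rule exec_clear) simp

lemma pr_Suc: "pr Suc"
  by (rule prI[where P = Inc], rule exec_Inc)

lemma pr_pfst: "pr pfst"
  by (rule prI[where P = "\<lambda>b. Seq (unpair_prog b) (clear (b + 1))"],
      rule exec_Seq[OF exec_unpair_prog[OF _ _ refl]], simp, simp, rule exec_clear) (auto simp: fun_eq_iff)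

lemma pr_psnd: "pr psnd"
  by (rule prI[where P = "\<lambda>b. Seq (unpair_prog b) (Seq (clear b) (move_reg (b + 1) b))"],
      rule exec_Seq[OF exec_unpair_prog[OF _ _ refl]], simp, simp,
      rule exec_Seq[OF exec_clear[OF refl]], rule exec_move_reg) (auto simp: fun_eq_iff)

lemma pr_prod_encode:
  assumes "pr f" "pr g"
  shows "pr (\<lambda>x. prod_encode (f x, g x))"
proof -
  from assms(1) obtain P where P: "\<And>b s s'. (\<And>i. b < i \<Longrightarrow> s i = 0) \<Longrightarrow> s' = s(b := f (s b)) \<Longrightarrow> exec (P b) s s'"
    by (rule prE) blast
  from assms(2) obtain Q where Q: "\<And>b s s'. (\<And>i. b < i \<Longrightarrow> s i = 0) \<Longrightarrow> s' = s(b := g (s b)) \<Longrightarrow> exec (Q b) s s'"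
    by (rule prE) blast
  show ?thesis
  proof (rule prI[where P = "\<lambda>b. Seq (spread_reg b (b + 1) (b + 2)) (Seq (P (b + 2))
      (Seq (move_reg (b + 2) b) (Seq (Q (b + 1)) (pair_prog b))))"], intro exec_Seq)
    fix b and s :: "nat \<Rightarrow> nat"
    assume s: "\<And>i. b < i \<Longrightarrow> s i = 0"
    show "exec (spread_reg b (b + 1) (b + 2)) s (s(b := 0, b + 1 := s b, b + 2 := s b))"
      using s by (intro exec_spread_reg) (auto simp: fun_eq_iff)
    show "exec (P (b + 2)) (s(b := 0, b + 1 := s b, b + 2 := s b)) (s(b := 0, b + 1 := s b, b + 2 := f (s b)))"
      using s by (intro P) (auto simp: fun_eq_iff)
    show "exec (move_reg (b + 2) b) (s(b := 0, b + 1 := s b, b + 2 := f (s b))) (s(b := f (s b), b + 1 := s b))"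
      using s by (intro exec_move_reg) (auto simp: fun_eq_iff)
    show "exec (Q (b + 1)) (s(b := f (s b), b + 1 := s b)) (s(b := f (s b), b + 1 := g (s b)))"
      using s by (intro Q) (auto simp: fun_eq_iff)
    show "exec (pair_prog b) (s(b := f (s b), b + 1 := g (s b))) (s(b := prod_encode (f (s b), g (s b))))"
      using s by (intro exec_pair_prog) (auto simp: fun_eq_iff)
  qed
qed

lemma pr_funpow_base:
  assumes "pr f"
  shows "pr (\<lambda>x. (f ^^ pfst x) (psnd x))"
proof -
  from assms(1) obtain P where P: "\<And>b s s'. (\<And>i. b < i \<Longrightarrow> s i = 0) \<Longrightarrow> s' = s(b := f (s b)) \<Longrightarrow> exec (P b) s s'"
    by (rule prE) blast
  show ?thesis
  proof (rule prI[where P = "\<lambda>b. Seq (unpair_prog b) (Seq (While b (Seq (Dec b) (P (b + 1))))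
      (move_reg (b + 1) b))"], intro exec_Seq)
    fix b and s :: "nat \<Rightarrow> nat"
    assume s: "\<And>i. b < i \<Longrightarrow> s i = 0"
    let ?\<sigma> = "\<lambda>k. s(b := k, b + 1 := (f ^^ (pfst (s b) - k)) (psnd (s b)))"
    show "exec (unpair_prog b) s (?\<sigma> (pfst (s b)))"
      using s by (intro exec_unpair_prog) auto
    show "exec (While b (Seq (Dec b) (P (b + 1)))) (?\<sigma> (pfst (s b))) (?\<sigma> 0)"
    proof (rule exec_loop)
      fix k assume k: "k < pfst (s b)"
      have "(f ^^ (pfst (s b) - k)) (psnd (s b)) = f ((f ^^ (pfst (s b) - Suc k)) (psnd (s b)))"
        using k Suc_diff_Suc[OF k] by (metis funpow.simps(2) o_apply)
      then show "exec (P (b + 1)) ((?\<sigma> (Suc k))(b := k)) (?\<sigma> k)"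
        using s by (intro P) (auto simp: fun_eq_iff)
    qed simp
    show "exec (move_reg (b + 1) b) (?\<sigma> 0) (s(b := (f ^^ pfst (s b)) (psnd (s b))))"
      using s by (intro exec_move_reg) (auto simp: fun_eq_iff)
  qed
qed

section \<open>Primitive recursive functions\<close>

definition prp :: "(nat \<Rightarrow> bool) \<Rightarrow> bool" where
  "prp P \<longleftrightarrow> pr (\<lambda>x. if P x then 1 else 0)"

named_theorems pr_intros

lemma pr_const [pr_intros]: "pr (\<lambda>x. k)"
proof (induction k)
  case (Suc k)
  then show ?case by (rule pr_comp[OF pr_Suc])
qed (rule pr_zero)

lemmas pr_base [pr_intros] =
  pr_id pr_comp[OF pr_Suc] pr_comp[OF pr_pfst] pr_comp[OF pr_psnd] pr_prod_encode

text \<open>Carrying \<open>x\<close> along in the state turns a step that depends on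
  \<open>x\<close> into one fixed function, to which the plain iteration applies.\<close>

lemma pr_funpow [pr_intros]:
  assumes "pr n" "pr a" "pr (\<lambda>z. h (pfst z) (psnd z))"
  shows "pr (\<lambda>x. (h x ^^ n x) (a x))"
proof -
  define F where "F z = prod_encode (pfst z, h (pfst z) (psnd z))" for z
  have "pr (\<lambda>x. (F ^^ pfst x) (psnd x))"
    unfolding F_def by (intro pr_funpow_base pr_intros assms)
  from pr_comp[OF pr_psnd pr_comp[OF this, of "\<lambda>x. prod_encode (n x, prod_encode (x, a x))"]]
  have "pr (\<lambda>x. psnd ((F ^^ n x) (prod_encode (x, a x))))"
    by (simp add: pr_intros assms)
  moreover have "(F ^^ k) (prod_encode (x, y)) = prod_encode (x, (h x ^^ k) y)" for k x y
    by (induction k) (simp_all add: F_def)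
  ultimately show ?thesis by simp
qed

lemma pr_rec_nat [pr_intros]:
  assumes "pr a" "pr (\<lambda>z. h (pfst z) (pfst (psnd z)) (psnd (psnd z)))" "pr n"
  shows "pr (\<lambda>x. rec_nat (a x) (h x) (n x))"
proof -
  define F where "F x s = prod_encode (Suc (pfst s), h x (pfst s) (psnd s))" for x s
  have "pr (\<lambda>z. h (pfst z) (pfst (psnd z)) (psnd (psnd z)))" by fact
  then have "pr (\<lambda>x. psnd ((F x ^^ n x) (prod_encode (0, a x))))"
    unfolding F_def by (intro pr_intros assms)
  moreover have "(F x ^^ k) (prod_encode (0, y)) = prod_encode (k, rec_nat y (h x) k)" for k x y
    by (induction k) (simp_all add: F_def)
  ultimately show ?thesis by simp
qed

lemma pr_add [pr_intros]:
  assumes "pr f" "pr g" shows "pr (\<lambda>x. f x + g x)"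
proof -
  have "a + b = rec_nat a (\<lambda>_ r. Suc r) b" for a b by (induction b) simp_all
  then show ?thesis by (simp only:) (intro pr_intros assms)
qed

lemma pr_mult [pr_intros]:
  assumes "pr f" "pr g" shows "pr (\<lambda>x. f x * g x)"
proof -
  have "a * b = rec_nat 0 (\<lambda>_ r. a + r) b" for a b by (induction b) simp_all
  then show ?thesis by (simp only:) (intro pr_intros assms pr_comp[OF assms(1)])
qed

lemma pr_diff [pr_intros]:
  assumes "pr f" "pr g" shows "pr (\<lambda>x. f x - g x)"
proof -
  \<comment> \<open>The inner \<open>rec_nat\<close> is the predecessor function.\<close>
  have "a - b = rec_nat a (\<lambda>_ r. rec_nat 0 (\<lambda>i _. i) r) b" for a b
  proof (induction b)
    case (Suc b)
    have "a - Suc b = rec_nat 0 (\<lambda>i _. i) (a - b)" by (cases "a - b") simp_all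
    then show ?case using Suc by simp
  qed simp
  then show ?thesis by (simp only:) (intro pr_intros assms)
qed

lemma pr_if [pr_intros]:
  assumes "prp P" "pr f" "pr g" shows "pr (\<lambda>x. if P x then f x else g x)"
proof -
  have "pr (\<lambda>x. (if P x then 1 else 0) * f x + (1 - (if P x then 1 else 0)) * g x)"
    by (intro pr_intros assms assms(1)[unfolded prp_def])
  moreover have "(\<lambda>x. (if P x then 1 else 0) * f x + (1 - (if P x then 1 else 0)) * g x)
      = (\<lambda>x. if P x then f x else g x)" by auto
  ultimately show ?thesis by (simp only:)
qed

lemma prp_const [pr_intros]: "prp (\<lambda>x. b)"
  unfolding prp_def by (rule pr_const)

lemma prp_not [pr_intros]:
  assumes "prp P" shows "prp (\<lambda>x. \<not> P x)"
proof -
  have "(if \<not> a then 1 else 0) = (if a then 0 else (1 :: nat))" for a by simp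
  then show ?thesis unfolding prp_def by (simp only:) (intro pr_intros assms)
qed

lemma prp_conj [pr_intros]:
  assumes "prp P" "prp Q" shows "prp (\<lambda>x. P x \<and> Q x)"
proof -
  have "(if a \<and> b then 1 else 0) = (if a then if b then 1 else 0 else (0 :: nat))" for a b by simp
  then show ?thesis unfolding prp_def by (simp only:) (intro pr_intros assms)
qed

lemma prp_disj [pr_intros]:
  assumes "prp P" "prp Q" shows "prp (\<lambda>x. P x \<or> Q x)"
proof -
  have "(if a \<or> b then 1 else 0) = (if a then 1 else if b then 1 else (0 :: nat))" for a b by simp
  then show ?thesis unfolding prp_def by (simp only:) (intro pr_intros assms)
qed

lemma prp_imp [pr_intros]:
  assumes "prp P" "prp Q" shows "prp (\<lambda>x. P x \<longrightarrow> Q x)"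
  unfolding imp_conv_disj by (intro pr_intros assms)

lemma prp_le [pr_intros]:
  assumes "pr f" "pr g" shows "prp (\<lambda>x. f x \<le> g x)"
proof -
  have "(if a \<le> b then 1 else 0) = 1 - (a - b)" for a b :: nat by auto
  then show ?thesis unfolding prp_def by (simp only:) (intro pr_intros assms)
qed

lemma prp_less [pr_intros]:
  assumes "pr f" "pr g" shows "prp (\<lambda>x. f x < g x)"
  unfolding less_eq_Suc_le by (intro pr_intros assms)

lemma prp_eq [pr_intros]:
  assumes "pr f" "pr g" shows "prp (\<lambda>x. f x = g x)"
  unfolding eq_iff by (intro pr_intros assms)

section \<open>Bounded quantifiers, lists and streams\<close>

lemma prp_bex [pr_intros]:
  assumes "prp (\<lambda>z. P (pfst z) (psnd z))" "pr n"
  shows "prp (\<lambda>x. \<exists>i<n x. P x i)"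
proof -
  have eq: "(if \<exists>i<k. Q i then 1 else (0 :: nat)) = rec_nat 0 (\<lambda>i r. if Q i then 1 else r) k" for k and Q :: "nat \<Rightarrow> bool"
  proof (induction k)
    case (Suc k)
    have "(\<exists>i<Suc k. Q i) \<longleftrightarrow> Q k \<or> (\<exists>i<k. Q i)" by (auto simp: less_Suc_eq)
    then show ?case by (simp add: Suc.IH[symmetric])
  qed simp
  have p: "prp (\<lambda>z. P (pfst z) (pfst (psnd z)))"
    using pr_comp[OF assms(1)[unfolded prp_def], of "\<lambda>z. prod_encode (pfst z, pfst (psnd z))"]
    unfolding prp_def by (simp add: pr_intros)
  show ?thesis unfolding prp_def eq by (intro pr_intros assms p)
qed

lemma prp_ball [pr_intros]:
  assumes "prp (\<lambda>z. P (pfst z) (psnd z))" "pr n"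
  shows "prp (\<lambda>x. \<forall>i<n x. P x i)"
proof -
  have "prp (\<lambda>x. \<not> (\<exists>i<n x. \<not> P x i))" by (intro pr_intros assms)
  then show ?thesis by simp
qed

lemma prp_ball_le [pr_intros]:
  assumes "prp (\<lambda>z. P (pfst z) (psnd z))" "pr n"
  shows "prp (\<lambda>x. \<forall>i\<le>n x. P x i)"
  unfolding less_Suc_eq_le[symmetric] by (intro pr_intros assms)

lemma prp_finite_ball [pr_intros]:
  assumes "finite S" "\<And>s. s \<in> S \<Longrightarrow> prp (P s)"
  shows "prp (\<lambda>x. \<forall>s\<in>S. P s x)"
  using assms by (induction S rule: finite_induct) (simp_all add: pr_intros)

lemma prp_mem_finite [pr_intros]:
  assumes "finite S" "pr f" shows "prp (\<lambda>x. f x \<in> S)"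
  using assms(1)
proof (induction S rule: finite_induct)
  case (insert s S)
  then show ?case unfolding insert_iff by (intro pr_intros assms)
qed (simp add: pr_intros)

lemma psnd_le: "psnd n \<le> n"
  by (metis le_prod_encode_2 prod_encode_pfst_psnd)

lemma list_decode_Suc: "list_decode (Suc n) = pfst n # list_decode (psnd n)"
  by (simp add: pfst_def psnd_def split: prod.split)

text \<open>The code of a nonempty list exceeds the code of its tail, so the code itself is a
  sufficient number of rounds; once the list is exhausted, \<open>F\<close> idles.\<close>

lemma pr_fold [pr_intros]:
  assumes "pr (\<lambda>z. h (pfst z) (pfst (psnd z)) (psnd (psnd z)))" "pr c" "pr a"
  shows "pr (\<lambda>x. fold (h x) (list_decode (c x)) (a x))"
proof -
  define F where "F x s = (if pfst s = 0 then s
    else prod_encode (psnd (pfst s - 1), h x (pfst (pfst s - 1)) (psnd s)))" for x s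
  have h: "pr (\<lambda>z. h (pfst z) (pfst (pfst (psnd z) - 1)) (psnd (psnd z)))"
    using pr_comp[OF assms(1), of "\<lambda>z. prod_encode (pfst z, prod_encode (pfst (pfst (psnd z) - 1), psnd (psnd z)))"]
    by (simp add: pr_intros)
  have "pr (\<lambda>x. psnd ((F x ^^ c x) (prod_encode (c x, a x))))"
    unfolding F_def by (intro pr_intros assms h)
  moreover have "n \<le> k \<Longrightarrow> psnd ((F x ^^ k) (prod_encode (n, y))) = fold (h x) (list_decode n) y" for n k x y
  proof (induction k arbitrary: n y)
    case (Suc k)
    show ?case
    proof (cases n)
      case 0
      have "(F x ^^ j) (prod_encode (0, y)) = prod_encode (0, y)" for j
        by (induction j) (simp_all add: F_def)
      then show ?thesis using 0 by (simp del: funpow.simps)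
    next
      case (Suc m)
      have "psnd m \<le> k" using Suc.prems Suc psnd_le[of m] by simp
      from Suc.IH[OF this] show ?thesis
        using Suc by (simp add: funpow_swap1 F_def[of x "prod_encode _"] list_decode_Suc del: list_decode.simps(2))
    qed
  qed simp
  ultimately show ?thesis by simp
qed

lemma prp_ball_list [pr_intros]:
  assumes "prp (\<lambda>z. P (pfst z) (psnd z))" "pr c"
  shows "prp (\<lambda>x. \<forall>e\<in>set (list_decode (c x)). P x e)"
proof -
  have z: "fold (\<lambda>e r. if Q e then r else 0) xs 0 = (0::nat)" for xs and Q :: "nat \<Rightarrow> bool"
    by (induction xs) auto
  have eq: "(if \<forall>e\<in>set xs. Q e then 1 else 0) = fold (\<lambda>e r. if Q e then r else 0) xs (1::nat)" for xs and Q :: "nat \<Rightarrow> bool"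
  proof (induction xs)
    case (Cons y ys)
    then show ?case by (cases "Q y") (simp_all add: z)
  qed simp
  have p: "prp (\<lambda>z. P (pfst z) (pfst (psnd z)))"
    using pr_comp[OF assms(1)[unfolded prp_def], of "\<lambda>z. prod_encode (pfst z, pfst (psnd z))"]
    unfolding prp_def by (simp add: pr_intros)
  show ?thesis unfolding prp_def eq by (intro pr_intros assms p)
qed

lemma prp_bex_list [pr_intros]:
  assumes "prp (\<lambda>z. P (pfst z) (psnd z))" "pr c"
  shows "prp (\<lambda>x. \<exists>e\<in>set (list_decode (c x)). P x e)"
proof -
  have "prp (\<lambda>x. \<not> (\<forall>e\<in>set (list_decode (c x)). \<not> P x e))" by (intro pr_intros assms)
  then show ?thesis by simp
qed

lemma pr_length [pr_intros]:
  assumes "pr c" shows "pr (\<lambda>x. length (list_decode (c x)))"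
proof -
  have "fold (\<lambda>_ r. Suc r) xs k = k + length xs" for xs :: "nat list" and k by (induction xs arbitrary: k) simp_all
  then have "length xs = fold (\<lambda>_ r. Suc r) xs 0" for xs :: "nat list" by simp
  then show ?thesis by (simp only:) (intro pr_intros assms)
qed

lemma pr_div2 [pr_intros]:
  assumes "pr f" shows "pr (\<lambda>x. f x div 2)"
proof -
  have "n div 2 = rec_nat 0 (\<lambda>i r. i - r) n" for n :: nat
  proof (induction n)
    case (Suc n)
    have "Suc n div 2 = n - n div 2" by arith
    then show ?case using Suc by simp
  qed simp
  then show ?thesis by (simp only:) (intro pr_intros assms)
qed

lemma prp_even [pr_intros]:
  assumes "pr f" shows "prp (\<lambda>x. even (f x))"
proof -
  have "even n \<longleftrightarrow> n = n div 2 + n div 2" for n :: nat by arith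
  then show ?thesis by (simp only:) (intro pr_intros assms)
qed

lemma prp_set_decode [pr_intros]:
  assumes "pr f" "pr g" shows "prp (\<lambda>x. f x \<in> set_decode (g x))"
proof -
  have "((\<lambda>y. y div 2) ^^ i) a = a div 2 ^ i" for a i :: nat
    by (induction i) (simp_all add: div_mult2_eq[symmetric] mult.commute)
  then have "i \<in> set_decode a \<longleftrightarrow> \<not> even (((\<lambda>y. y div 2) ^^ i) a)" for a i
    by (simp add: set_decode_def)
  then show ?thesis by (simp only:) (intro pr_intros assms)
qed

definition lnth :: "nat \<Rightarrow> nat \<Rightarrow> nat" where
  "lnth c i = pfst (((\<lambda>c. psnd (c - 1)) ^^ i) c - 1)"

lemma pr_lnth [pr_intros]:
  assumes "pr f" "pr g" shows "pr (\<lambda>x. lnth (f x) (g x))"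
  unfolding lnth_def by (intro pr_intros assms)

lemma lnth_nth: "i < length (list_decode c) \<Longrightarrow> lnth c i = list_decode c ! i"
proof (induction i arbitrary: c)
  case 0
  then show ?case by (cases c) (simp_all add: lnth_def list_decode_Suc del: list_decode.simps(2))
next
  case (Suc i)
  show ?case
  proof (cases c)
    case (Suc m)
    have "lnth c (Suc i) = lnth (psnd m) i"
      using Suc by (simp add: lnth_def funpow_Suc_right del: funpow.simps)
    then show ?thesis using Suc Suc.IH[of "psnd m"] Suc.prems by (simp add: list_decode_Suc del: list_decode.simps(2))
  qed (use Suc.prems in simp)
qed

text \<open>Through \<open>prod_decode\<close>, a number is a stream that is eventually 0, since
  \<open>prod_decode 0 = (0, 0)\<close>.\<close>

definition sth :: "nat \<Rightarrow> nat \<Rightarrow> nat" where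
  "sth w i = pfst ((psnd ^^ i) w)"

lemma pr_sth [pr_intros]:
  assumes "pr f" "pr g" shows "pr (\<lambda>x. sth (f x) (g x))"
  unfolding sth_def by (intro pr_intros assms)

lemma sth_simps [simp]: "sth w 0 = pfst w" "sth w (Suc i) = sth (psnd w) i"
  by (simp_all add: sth_def funpow_swap1)

lemma sth_zero [simp]: "sth 0 i = 0"
  by (induction i) simp_all

text \<open>The value 0 stands for an absent key, and \<open>Suc v\<close> for the value \<open>v\<close>.\<close>

definition assoc_find :: "nat \<Rightarrow> nat \<Rightarrow> nat" where
  "assoc_find c k = fold (\<lambda>e r. if r = 0 \<and> pfst e = k then Suc (psnd e) else r) (list_decode c) 0"

lemma pr_assoc_find [pr_intros]:
  assumes "pr f" "pr g" shows "pr (\<lambda>x. assoc_find (f x) (g x))"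
  unfolding assoc_find_def by (intro pr_intros assms pr_comp[OF assms(2)])

lemma assoc_find_map_of:
  assumes "inj key"
  shows "map_of (map (\<lambda>e. (key (pfst e), val (psnd e))) (list_decode c)) (key k)
    = (case assoc_find c k of 0 \<Rightarrow> None | Suc v \<Rightarrow> Some (val v))"
proof -
  have *: "fold (\<lambda>e r. if r = 0 \<and> pfst e = k then Suc (psnd e) else r) xs (Suc v) = Suc v" for xs v k
    by (induction xs) auto
  have "map_of (map (\<lambda>e. (key (pfst e), val (psnd e))) xs) (key k)
    = (case fold (\<lambda>e r. if r = 0 \<and> pfst e = k then Suc (psnd e) else r) xs 0 of 0 \<Rightarrow> None | Suc v \<Rightarrow> Some (val v))" for xs
    by (induction xs) (auto simp: * inj_eq[OF assms])
  then show ?thesis by (simp add: assoc_find_def)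
qed

section \<open>Simulation of Turing machines\<close>

text \<open>A machine configuration is coded as \<open>(q, (l, r))\<close>, where the stream \<open>r\<close> is the tape from the head
  to the right and \<open>l\<close> is the tape from the cell left of the head to the left.\<close>

definition sim_lookup :: "nat \<Rightarrow> nat \<Rightarrow> nat" where
  "sim_lookup m z = assoc_find m (prod_encode (pfst z, pfst (psnd (psnd z))))"

text \<open>\<open>v\<close> packs the new state, the written symbol and the move, numbered as in
  \<open>move_of\<close>. A move passes one symbol from one stream to the other.\<close>

definition sim_apply :: "nat \<Rightarrow> nat \<Rightarrow> nat \<Rightarrow> nat" where
  "sim_apply v l r =
    (if psnd (psnd v) = 0 then
       prod_encode (pfst v, prod_encode (psnd l, prod_encode (pfst l, prod_encode (pfst (psnd v), psnd r))))
     else if psnd (psnd v) = 1 then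
       prod_encode (pfst v, prod_encode (l, prod_encode (pfst (psnd v), psnd r)))
     else
       prod_encode (pfst v, prod_encode (prod_encode (pfst (psnd v), l), psnd r)))"

text \<open>A halted configuration is a fixed point, which makes iteration total; \<open>- 1\<close>
  undoes the \<open>Suc\<close> that marks a found entry.\<close>

definition sim_step :: "nat \<Rightarrow> nat \<Rightarrow> nat" where
  "sim_step m z = (if sim_lookup m z = 0 then z
     else sim_apply (sim_lookup m z - 1) (pfst (psnd z)) (psnd (psnd z)))"

definition sim_init :: "nat \<Rightarrow> nat" where
  "sim_init n = prod_encode (0, prod_encode (0, ((\<lambda>y. prod_encode (1, y)) ^^ n) 0))"

definition sim_result :: "nat \<Rightarrow> nat \<Rightarrow> nat \<Rightarrow> nat \<Rightarrow> bool" where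
  "sim_result m n k t \<longleftrightarrow> sim_lookup m ((sim_step m ^^ t) (sim_init n)) = 0 \<and>
     (\<forall>i<k. sth (psnd (psnd ((sim_step m ^^ t) (sim_init n)))) i = 1) \<and>
     sth (psnd (psnd ((sim_step m ^^ t) (sim_init n)))) k \<noteq> 1"

lemma prp_sim_result [pr_intros]:
  assumes "pr m" "pr n" "pr k" "pr t"
  shows "prp (\<lambda>x. sim_result (m x) (n x) (k x) (t x))"
  unfolding sim_result_def sim_lookup_def sim_step_def sim_apply_def sim_init_def
  by (intro pr_intros assms assms[THEN pr_comp])

lemma tm_of_lookup:
  "tm_of m (q, c) = (case assoc_find m (prod_encode (q, c)) of 0 \<Rightarrow> None
     | Suc v \<Rightarrow> Some (pfst v, pfst (psnd v), move_of (psnd (psnd v))))"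
proof -
  let ?val = "\<lambda>v. (pfst v, pfst (psnd v), move_of (psnd (psnd v)))"
  have "transition_of = (\<lambda>e. (prod_decode (pfst e), ?val (psnd e)))"
    by (auto simp: transition_of_def pfst_def psnd_def fun_eq_iff split: prod.split)
  then have "tm_of m (q, c)
      = map_of (map (\<lambda>e. (prod_decode (pfst e), ?val (psnd e))) (list_decode m)) (prod_decode (prod_encode (q, c)))"
    by (simp add: tm_of_def)
  also have "\<dots> = (case assoc_find m (prod_encode (q, c)) of 0 \<Rightarrow> None | Suc v \<Rightarrow> Some (?val v))"
    by (rule assoc_find_map_of[OF bij_prod_decode[THEN bij_is_inj]])
  finally show ?thesis .
qed

fun sim_rep :: "nat \<Rightarrow> tm_config \<Rightarrow> bool" where
  "sim_rep z (q, h, t) \<longleftrightarrow> pfst z = q \<and> (\<forall>i. sth (psnd (psnd z)) i = t (h + int i)) \<and>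
     (\<forall>i. sth (pfst (psnd z)) i = t (h - 1 - int i))"

lemma sim_rep_init: "sim_rep (sim_init n) (tm_init n)"
proof -
  have "sth (((\<lambda>y. prod_encode (1, y)) ^^ n) 0) i = (if i < n then 1 else 0)" for i
  proof (induction n arbitrary: i)
    case (Suc n)
    then show ?case by (cases i) simp_all
  qed simp
  then show ?thesis by (simp add: sim_init_def tm_init_def)
qed

lemma sim_rep_step:
  assumes "sim_rep z c"
  shows "case tm_step (tm_of m) c of None \<Rightarrow> sim_lookup m z = 0
    | Some c' \<Rightarrow> sim_lookup m z \<noteq> 0 \<and> sim_rep (sim_step m z) c'"
proof -
  obtain q h t where c: "c = (q, h, t)" by (cases c) auto
  have q: "pfst z = q" and r: "\<And>i. sth (psnd (psnd z)) i = t (h + int i)"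
    and l: "\<And>i. sth (pfst (psnd z)) i = t (h - 1 - int i)"
    using assms by (simp_all add: c)
  have look: "tm_of m (q, t h) = (case sim_lookup m z of 0 \<Rightarrow> None
     | Suc v \<Rightarrow> Some (pfst v, pfst (psnd v), move_of (psnd (psnd v))))"
    using r[of 0] q by (simp add: tm_of_lookup sim_lookup_def)
  show ?thesis
  proof (cases "sim_lookup m z")
    case 0
    then show ?thesis using look by (simp add: c)
  next
    case (Suc v)
    let ?a = "pfst (psnd v)" and ?t = "t(h := pfst (psnd v))"
    have r': "sth (psnd (psnd (psnd z))) i = t (h + 1 + int i)" for i
      using r[of "Suc i"] by (simp add: algebra_simps)
    have l': "sth (psnd (pfst (psnd z))) i = t (h - 2 - int i)" for i
      using l[of "Suc i"] by (simp add: algebra_simps)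
    have l0: "pfst (pfst (psnd z)) = t (h - 1)"
      using l[of 0] by simp
    have push: "sth (prod_encode (a, w)) i = (if i = 0 then a else sth w (i - 1))" for a w i
      by (cases i) simp_all
    have "sim_rep (sim_apply v (pfst (psnd z)) (psnd (psnd z))) (pfst v, h + shift_of (move_of (psnd (psnd v))), ?t)"
      unfolding sim_apply_def move_of_def
      by (auto simp: push r' l' l l0 algebra_simps of_nat_diff)
    then show ?thesis
      using Suc look by (simp add: c sim_step_def)
  qed
qed

lemma sim_rep_funpow: "\<exists>c. steps (tm_of m) (tm_init n) c \<and> sim_rep ((sim_step m ^^ t) (sim_init n)) c"
proof (induction t)
  case 0
  show ?case by (rule exI[of _ "tm_init n"]) (simp add: sim_rep_init)
next
  case (Suc t)
  then obtain c where c: "steps (tm_of m) (tm_init n) c" "sim_rep ((sim_step m ^^ t) (sim_init n)) c" by blast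
  show ?case
  proof (cases "tm_step (tm_of m) c")
    case None
    then have "(sim_step m ^^ Suc t) (sim_init n) = (sim_step m ^^ t) (sim_init n)"
      using sim_rep_step[OF c(2), of m] by (simp add: sim_step_def[of m "(sim_step m ^^ t) (sim_init n)"])
    then show ?thesis using c by metis
  next
    case (Some c')
    then have "steps (tm_of m) (tm_init n) c'"
      using c(1) unfolding steps_def by (rule rtranclp.rtrancl_into_rtrancl[rotated])
    moreover have "sim_rep ((sim_step m ^^ Suc t) (sim_init n)) c'"
      using Some sim_rep_step[OF c(2), of m] by simp
    ultimately show ?thesis by blast
  qed
qed

lemma sim_rep_steps: "steps (tm_of m) (tm_init n) c \<Longrightarrow> \<exists>t. sim_rep ((sim_step m ^^ t) (sim_init n)) c"
  unfolding steps_def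
proof (induction rule: rtranclp_induct)
  case base
  show ?case by (rule exI[of _ 0]) (simp add: sim_rep_init)
next
  case (step c c')
  then obtain t where "sim_rep ((sim_step m ^^ t) (sim_init n)) c" by blast
  from sim_rep_step[OF this, of m] have "sim_rep ((sim_step m ^^ Suc t) (sim_init n)) c'"
    using step.hyps(2) by simp
  then show ?case by blast
qed

text \<open>The running time becomes an existential witness for a decidable relation, so that every
  condition on enumerated outputs can be brought into the form of a projection.\<close>

lemma tm_result_iff: "tm_result (tm_of m) n k \<longleftrightarrow> (\<exists>t. sim_result m n k t)"
proof
  assume "tm_result (tm_of m) n k"
  then obtain q h t where 1: "steps (tm_of m) (tm_init n) (q, h, t)" "tm_step (tm_of m) (q, h, t) = None"
    "\<forall>i<k. t (h + int i) = 1" "t (h + int k) \<noteq> 1"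
    unfolding tm_result_def steps_def by blast
  obtain u where u: "sim_rep ((sim_step m ^^ u) (sim_init n)) (q, h, t)"
    using sim_rep_steps[OF 1(1)] by blast
  have "sim_result m n k u"
    unfolding sim_result_def using 1(2-4) u sim_rep_step[OF u, of m] by simp
  then show "\<exists>t. sim_result m n k t" ..
next
  assume "\<exists>t. sim_result m n k t"
  then obtain u where u: "sim_result m n k u" ..
  obtain q h t where 1: "steps (tm_of m) (tm_init n) (q, h, t)"
    "sim_rep ((sim_step m ^^ u) (sim_init n)) (q, h, t)"
    using sim_rep_funpow[of m n u] by auto
  then show "tm_result (tm_of m) n k"
    using u sim_rep_step[OF 1(2), of m] unfolding sim_result_def tm_result_def steps_def
    by (intro exI[of _ q] exI[of _ h] exI[of _ t]) (auto split: option.splits)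
qed

lemma tm_enumerates_iff: "k \<in> tm_enumerates (tm_of m) \<longleftrightarrow> (\<exists>n t. sim_result m n k t)"
  by (simp add: tm_enumerates_def tm_result_iff)

section \<open>\<open>\<Sigma>\<close> sets as ranges and projections\<close>

lemma Sigma01_range: "computable f \<Longrightarrow> Sigma01 (range f)"
proof -
  assume "computable f"
  then obtain M where M: "finite (dom M)" "\<And>n. tm_result M n (f n)"
    unfolding computable_def by blast
  then have "range f = tm_enumerates M"
    unfolding tm_enumerates_def using tm_result_unique by blast
  then show ?thesis
    unfolding Sigma01_def using M(1) by blast
qed

text \<open>The empty set is no range of a total function and needs a machine that never halts.
  Input tapes carry only 0 and 1, so two idle transitions suffice.\<close>

lemma Sigma01_empty: "Sigma01 {}"
proof -
  define M :: tm where "M = [(0, 0) \<mapsto> (0, 0, Stay), (0, 1) \<mapsto> (0, 1, Stay)]"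
  have inv: "fst c = 0 \<and> snd (snd c) = snd (snd (tm_init n)) \<and> fst (snd c) = 0"
    if "steps M (tm_init n) c" for n c
    using that unfolding steps_def
    by (induction rule: rtranclp_induct) (auto simp: tm_init_def M_def split: if_splits option.splits)
  have "\<not> tm_result M n k" for n k
  proof
    assume "tm_result M n k"
    then obtain q h t where 1: "steps M (tm_init n) (q, h, t)" "tm_step M (q, h, t) = None"
      unfolding tm_result_def steps_def by blast
    then show False using inv[OF 1(1)] by (auto simp: tm_init_def M_def split: if_splits)
  qed
  then have "tm_enumerates M = {}"
    by (simp add: tm_enumerates_def)
  moreover have "finite (dom M)"
    by (simp add: M_def)
  ultimately show ?thesis
    unfolding Sigma01_def by metis
qed

lemma Sigma01_projection:
  assumes "prp (\<lambda>z. R (pfst z) (psnd z))"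
  shows "Sigma01 {x. \<exists>t. R x t}"
proof (cases "{x. \<exists>t. R x t} = {}")
  case True
  then show ?thesis by (simp only: Sigma01_empty)
next
  case False
  then obtain x0 where x0: "\<exists>t. R x0 t" by blast
  \<comment> \<open>Pairs that are no witnesses are sent to \<open>x0\<close>, which keeps
    \<open>f\<close> total without enlarging its range.\<close>
  define f where "f z = (if R (pfst z) (psnd z) then pfst z else x0)" for z
  have "pr f"
    unfolding f_def by (intro pr_intros assms)
  have "x = f (prod_encode (x, t))" if "R x t" for x t
    using that by (simp add: f_def)
  then have "{x. \<exists>t. R x t} \<subseteq> range f"
    by blast
  moreover have "range f \<subseteq> {x. \<exists>t. R x t}"
    using x0 by (auto simp: f_def)
  ultimately have "range f = {x. \<exists>t. R x t}" by blast
  then show ?thesis using Sigma01_range[OF pr_computable[OF \<open>pr f\<close>]] by simp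
qed

section \<open>Inclusion of effective subshifts in a subshift of finite type\<close>

definition vec :: "nat \<Rightarrow> int list" where
  "vec v = map int_decode (list_decode v)"

definition vec_code :: "int list \<Rightarrow> nat" where
  "vec_code u = list_encode (map int_encode u)"

lemma vec_vec_code [simp]: "vec (vec_code u) = u"
  by (simp add: vec_def vec_code_def comp_def)

lemma vec_code_vec [simp]: "vec_code (vec v) = v"
  by (simp add: vec_def vec_code_def comp_def)

lemma vec_lattice: "vec v \<in> lattice d \<longleftrightarrow> length (list_decode v) = d"
  by (simp add: vec_def lattice_def)

lemma pattern_of_eq: "pattern_of c = map_of (map (\<lambda>e. (vec (pfst e), psnd e)) (list_decode c))"
proof -
  have "pattern_entry_of = (\<lambda>e. (vec (pfst e), psnd e))"
    by (simp add: fun_eq_iff pattern_entry_of_def vec_def prod_decode_eq)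
  then show ?thesis unfolding pattern_of_def by (simp only:)
qed

lemma pattern_of_vec:
  "pattern_of c (vec v) = (case assoc_find c v of 0 \<Rightarrow> None | Suc a \<Rightarrow> Some a)"
proof -
  have "inj vec" by (metis vec_code_vec injI)
  from assoc_find_map_of[OF this, of "\<lambda>a. a"] show ?thesis
    by (simp add: pattern_of_eq)
qed

lemma dom_pattern_of: "dom (pattern_of c) = (\<lambda>e. vec (pfst e)) ` set (list_decode c)"
  by (simp add: pattern_of_eq dom_map_of_conv_image_fst image_image)

lemma pattern_of_entry:
  assumes "e \<in> set (list_decode c)"
  obtains a where "assoc_find c (pfst e) = Suc a" "pattern_of c (vec (pfst e)) = Some a"
proof -
  have "vec (pfst e) \<in> dom (pattern_of c)"
    using assms by (simp only: dom_pattern_of) (rule imageI)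
  then show ?thesis
    using that by (auto simp: pattern_of_vec dom_def split: nat.splits)
qed

text \<open>The letter is looked up rather than read off the entry, because a later entry for the
  same key is shadowed and may carry any letter. The lookup of an occurring key is nonzero, so
  \<open>- 1\<close> is harmless.\<close>

definition in_patterns :: "nat \<Rightarrow> nat \<Rightarrow> nat \<Rightarrow> bool" where
  "in_patterns d a c \<longleftrightarrow> (\<forall>e\<in>set (list_decode c). length (list_decode (pfst e)) = d \<and>
     assoc_find c (pfst e) - 1 \<in> set_decode a)"

lemma prp_in_patterns [pr_intros]:
  assumes "pr a" "pr c" shows "prp (\<lambda>x. in_patterns d (a x) (c x))"
  unfolding in_patterns_def by (intro pr_intros assms assms[THEN pr_comp])

lemma in_patterns_iff: "in_patterns d a c \<longleftrightarrow> pattern_of c \<in> patterns d (set_decode a)"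
proof -
  have "ran (pattern_of c) = (\<lambda>e. assoc_find c (pfst e) - 1) ` set (list_decode c)" (is "?L = ?R")
  proof
    show "?L \<subseteq> ?R"
    proof
      fix b assume "b \<in> ?L"
      then obtain s where s: "pattern_of c s = Some b" by (auto simp: ran_def)
      then have "s \<in> dom (pattern_of c)" by (rule domI)
      then obtain e where e: "e \<in> set (list_decode c)" "s = vec (pfst e)"
        unfolding dom_pattern_of by blast
      show "b \<in> ?R"
        by (rule pattern_of_entry[OF e(1)]) (use s e in \<open>auto intro!: image_eqI[of _ _ e]\<close>)
    qed
    show "?R \<subseteq> ?L"
    proof
      fix b assume "b \<in> ?R"
      then obtain e where e: "e \<in> set (list_decode c)" "b = assoc_find c (pfst e) - 1" by blast
      show "b \<in> ?L"
        by (rule pattern_of_entry[OF e(1)]) (use e in \<open>auto intro!: ranI\<close>)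
    qed
  qed
  moreover have "finite (dom (pattern_of c))"
    unfolding dom_pattern_of by simp
  ultimately show ?thesis
    unfolding in_patterns_def patterns_def by (auto simp: dom_pattern_of vec_lattice)
qed

definition int_pos :: "nat \<Rightarrow> nat" where
  "int_pos n = (if even n then n div 2 else 0)"

definition int_neg :: "nat \<Rightarrow> nat" where
  "int_neg n = (if even n then 0 else Suc (n div 2))"

lemma int_decode_pos_neg: "int_decode n = int (int_pos n) - int (int_neg n)"
  by (simp add: int_decode_def sum_decode_def int_pos_def int_neg_def)

text \<open>Addition of vectors is only needed as a relation between codes, which avoids computing with
  negative numbers.\<close>

definition is_sum :: "nat \<Rightarrow> nat \<Rightarrow> nat \<Rightarrow> nat \<Rightarrow> bool" where
  "is_sum d u v w \<longleftrightarrow> length (list_decode w) = d \<and>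
     (\<forall>i<d. int_pos (lnth u i) + int_pos (lnth v i) + int_neg (lnth w i)
       = int_neg (lnth u i) + int_neg (lnth v i) + int_pos (lnth w i))"

lemma is_sum_iff:
  assumes "vec u \<in> lattice d" "vec v \<in> lattice d"
  shows "is_sum d u v w \<longleftrightarrow> w = vec_code (vec_add (vec u) (vec v))"
proof -
  have len: "length (list_decode u) = d" "length (list_decode v) = d"
    using assms by (simp_all add: vec_lattice)
  have "is_sum d u v w \<longleftrightarrow> length (list_decode w) = d \<and> (\<forall>i<d. vec w ! i = vec u ! i + vec v ! i)"
    unfolding is_sum_def using len
    by (intro conj_cong refl all_cong) (auto simp: vec_def lnth_nth int_decode_pos_neg)
  also have "\<dots> \<longleftrightarrow> vec w = vec_add (vec u) (vec v)"
    using len by (auto simp: list_eq_iff_nth_eq vec_add_def vec_def)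
  also have "\<dots> \<longleftrightarrow> w = vec_code (vec_add (vec u) (vec v))"
    by (metis vec_code_vec vec_vec_code)
  finally show ?thesis .
qed

lemma vec_add_lattice: "u \<in> lattice d \<Longrightarrow> v \<in> lattice d \<Longrightarrow> vec_add u v \<in> lattice d"
  by (simp add: lattice_def vec_add_def)

lemma vec_add_assoc: "vec_add u (vec_add v w) = vec_add (vec_add u v) w"
  unfolding vec_add_def
proof (induction u arbitrary: v w)
  case (Cons a u)
  then show ?case by (cases v; cases w) (simp_all add: add.assoc)
qed simp

lemma vec_add_zero: "u \<in> lattice d \<Longrightarrow> vec_add u (replicate d 0) = u"
  by (auto simp: lattice_def vec_add_def intro: nth_equalityI)

lemma vec_zero_add: "u \<in> lattice d \<Longrightarrow> vec_add (replicate d 0) u = u"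
  by (auto simp: lattice_def vec_add_def intro: nth_equalityI)

lemma replicate_lattice: "replicate d 0 \<in> lattice d"
  by (simp add: lattice_def)

text \<open>\<open>x\<close> is read only below \<open>N\<close>: this makes the test decidable and
  immune to changes of \<open>x\<close> from \<open>N\<close> on.\<close>

definition occurs :: "nat \<Rightarrow> (nat \<Rightarrow> nat) \<Rightarrow> nat \<Rightarrow> nat \<Rightarrow> nat \<Rightarrow> bool" where
  "occurs d x c u N \<longleftrightarrow> (\<forall>e\<in>set (list_decode c).
     \<exists>v<N. is_sum d u (pfst e) v \<and> Suc (x v) = assoc_find c (pfst e))"

lemma prp_occurs [pr_intros]:
  assumes "pr w" "pr c" "pr u" "pr N"
  shows "prp (\<lambda>z. occurs d (sth (w z)) (c z) (u z) (N z))"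
  unfolding occurs_def is_sum_def int_pos_def int_neg_def
  by (intro pr_intros assms assms[THEN pr_comp])

lemma occursD:
  assumes "occurs d x c u N" "pattern_of c \<in> patterns d A" "vec u \<in> lattice d" "s \<in> dom (pattern_of c)"
  shows "pattern_of c s = Some (x (vec_code (vec_add (vec u) s)))"
proof -
  obtain e where e: "e \<in> set (list_decode c)" "s = vec (pfst e)"
    using assms(4) unfolding dom_pattern_of by blast
  have "vec (pfst e) \<in> lattice d"
    using assms(2,4) e(2) by (auto simp: patterns_def)
  then show ?thesis
    using assms(1,3) e unfolding occurs_def by (auto simp: is_sum_iff pattern_of_vec split: nat.splits)
qed

lemma eventually_occurs:
  assumes "\<And>s. s \<in> dom (pattern_of c) \<Longrightarrow> pattern_of c s = Some (x (vec_code (vec_add (vec u) s)))"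
    and "pattern_of c \<in> patterns d A" "vec u \<in> lattice d"
  shows "eventually (occurs d x c u) sequentially"
  unfolding occurs_def
proof (intro eventually_ball_finite ballI finite_set)
  fix e assume e: "e \<in> set (list_decode c)"
  let ?s = "vec (pfst e)"
  have dom: "?s \<in> dom (pattern_of c)"
    using e unfolding dom_pattern_of by (rule imageI)
  then have "?s \<in> lattice d"
    using assms(2) by (auto simp: patterns_def)
  then have "is_sum d u (pfst e) (vec_code (vec_add (vec u) ?s))"
    using assms(3) by (simp add: is_sum_iff)
  moreover have "Suc (x (vec_code (vec_add (vec u) ?s))) = assoc_find c (pfst e)"
    using assms(1)[OF dom] by (auto simp: pattern_of_vec split: nat.splits)
  ultimately show "\<forall>\<^sub>F N in sequentially. \<exists>v<N. is_sum d u (pfst e) v \<and> Suc (x v) = assoc_find c (pfst e)"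
    by (intro eventually_mono[OF eventually_gt_at_top[of "vec_code (vec_add (vec u) ?s)"]]) blast
qed

text \<open>Here \<open>x\<close> colours the codes of vectors, and only its first \<open>N\<close> values are inspected.  A colouring is
  settled once these values exclude it from the effective subshift, or show that it respects the rules of
  the other subshift at the origin; up to a translation, the latter is membership.\<close>

definition off_alphabet :: "nat \<Rightarrow> nat \<Rightarrow> (nat \<Rightarrow> nat) \<Rightarrow> nat \<Rightarrow> bool" where
  "off_alphabet d a x N \<longleftrightarrow> (\<exists>i<N. length (list_decode i) = d \<and> x i \<notin> set_decode a)"

definition forbidden :: "nat \<Rightarrow> nat \<Rightarrow> nat \<Rightarrow> (nat \<Rightarrow> nat) \<Rightarrow> nat \<Rightarrow> bool" where
  "forbidden d a m x N \<longleftrightarrow> (\<exists>j<N. sim_result m (pfst (psnd j)) (pfst j) (pfst (psnd (psnd j))) \<and>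
     in_patterns d a (pfst j) \<and> length (list_decode (psnd (psnd (psnd j)))) = d \<and>
     occurs d x (pfst j) (psnd (psnd (psnd j))) N)"

definition legal_at_origin :: "nat \<Rightarrow> nat \<Rightarrow> nat set \<Rightarrow> (nat \<Rightarrow> nat) \<Rightarrow> nat \<Rightarrow> bool" where
  "legal_at_origin d b Fc x N \<longleftrightarrow> vec_code (replicate d 0) < N \<and> x (vec_code (replicate d 0)) \<in> set_decode b \<and>
     (\<forall>f\<in>Fc. \<exists>e\<in>set (list_decode f). pfst e < N \<and> Suc (x (pfst e)) \<noteq> assoc_find f (pfst e))"

definition settled :: "nat \<Rightarrow> nat \<Rightarrow> nat set \<Rightarrow> nat \<Rightarrow> nat \<Rightarrow> (nat \<Rightarrow> nat) \<Rightarrow> nat \<Rightarrow> bool" where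
  "settled d b Fc a m x N \<longleftrightarrow> off_alphabet d a x N \<or> forbidden d a m x N \<or> legal_at_origin d b Fc x N"

lemma prp_settled [pr_intros]:
  assumes "finite Fc" "pr a" "pr m" "pr w" "pr N"
  shows "prp (\<lambda>z. settled d b Fc (a z) (m z) (sth (w z)) (N z))"
  unfolding settled_def off_alphabet_def forbidden_def legal_at_origin_def
  by (intro pr_intros assms assms(2-)[THEN pr_comp])

text \<open>This is the continuity that the compactness argument requires: a verdict depends on a
  prefix and is never withdrawn.\<close>

lemma settled_mono:
  assumes "settled d b Fc a m x N" "N \<le> N'" "\<And>i. i < N \<Longrightarrow> x i = x' i"
  shows "settled d b Fc a m x' N'"
proof -
  have occ: "occurs d x' c u N'" if "occurs d x c u N" for c u
    using that assms(2,3) unfolding occurs_def by (metis order_less_le_trans)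
  consider "off_alphabet d a x N" | "forbidden d a m x N" | "legal_at_origin d b Fc x N"
    using assms(1) by (auto simp: settled_def)
  then show ?thesis
  proof cases
    case 1
    then have "off_alphabet d a x' N'"
      using assms(2,3) unfolding off_alphabet_def by (metis order_less_le_trans)
    then show ?thesis by (simp add: settled_def)
  next
    case 2
    then obtain j where "j < N" "sim_result m (pfst (psnd j)) (pfst j) (pfst (psnd (psnd j)))"
      "in_patterns d a (pfst j)" "length (list_decode (psnd (psnd (psnd j)))) = d"
      "occurs d x (pfst j) (psnd (psnd (psnd j))) N"
      unfolding forbidden_def by blast
    then have "forbidden d a m x' N'"
      using assms(2) occ unfolding forbidden_def by (intro exI[of _ j]) simp
    then show ?thesis by (simp add: settled_def)
  next
    case 3
    then have "legal_at_origin d b Fc x' N'"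
      using assms(2,3) unfolding legal_at_origin_def by (metis order_less_le_trans)
    then show ?thesis by (simp add: settled_def)
  qed
qed

text \<open>Two uses: the code of an alphabet bounds its letters, so colourings range over a compact
  space, and the code is itself a letter outside the alphabet.\<close>

lemma set_decode_less: "i \<in> set_decode a \<Longrightarrow> i < a"
proof (rule ccontr)
  assume i: "i \<in> set_decode a" "\<not> i < a"
  then have "a < 2 ^ i" by (meson less_exp le_less_trans not_le)
  then show False using i(1) by (simp add: set_decode_def)
qed

text \<open>A colouring that is never settled would restrict to a point of the effective subshift
  that breaks a rule of the other subshift at the origin. Conversely, each translate of a point of
  the effective subshift can only be settled by legality at the origin.\<close>

lemma effective_subset_iff:
  assumes F: "pattern_of ` Fc \<subseteq> patterns d (set_decode b)" and fin: "finite Fc"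
  shows "effective_subshift d (set_decode a) (tm_of m) \<subseteq> subshift d (set_decode b) (pattern_of ` Fc)
    \<longleftrightarrow> (\<forall>x. (\<forall>i. x i \<le> a) \<longrightarrow> (\<exists>N. settled d b Fc a m x N))"
    (is "?X \<subseteq> ?Y \<longleftrightarrow> _")
proof
  assume XY: "?X \<subseteq> ?Y"
  show "\<forall>x. (\<forall>i. x i \<le> a) \<longrightarrow> (\<exists>N. settled d b Fc a m x N)"
  proof (intro allI impI, rule ccontr)
    fix x :: "nat \<Rightarrow> nat"
    assume "\<nexists>N. settled d b Fc a m x N"
    then have off: "\<And>N. \<not> off_alphabet d a x N" and forb: "\<And>N. \<not> forbidden d a m x N"
      and legal: "\<And>N. \<not> legal_at_origin d b Fc x N"
      by (auto simp: settled_def)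
    define y where "y = restrict (\<lambda>v. x (vec_code v)) (lattice d)"
    have "x (vec_code v) \<in> set_decode a" if "v \<in> lattice d" for v
      using off[of "Suc (vec_code v)"] that vec_lattice[of "vec_code v" d] by (auto simp: off_alphabet_def)
    then have "y \<in> full_shift d (set_decode a)"
      by (auto simp: y_def full_shift_def)
    moreover have "\<not> appears d p y" if pF: "p \<in> pattern_of ` tm_enumerates (tm_of m) \<inter> patterns d (set_decode a)" for p
    proof
      assume "appears d p y"
      then obtain u where u: "u \<in> lattice d" "\<And>s. s \<in> dom p \<Longrightarrow> p s = Some (y (vec_add u s))"
        by (auto simp: appears_def)
      obtain c where "p = pattern_of c" "c \<in> tm_enumerates (tm_of m)"
        using pF by blast
      then obtain n t where c: "p = pattern_of c" "sim_result m n c t"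
        unfolding tm_enumerates_iff by blast
      have p: "pattern_of c \<in> patterns d (set_decode a)"
        using pF c by simp
      have "eventually (occurs d x c (vec_code u)) sequentially"
      proof (rule eventually_occurs[OF _ p])
        fix s assume s: "s \<in> dom (pattern_of c)"
        then have "vec_add u s \<in> lattice d"
          using p u(1) by (intro vec_add_lattice) (auto simp: patterns_def)
        then show "pattern_of c s = Some (x (vec_code (vec_add (vec (vec_code u)) s)))"
          using u(2)[of s] s by (simp add: c y_def)
      qed (simp add: u)
      then obtain N where N: "\<And>N'. N \<le> N' \<Longrightarrow> occurs d x c (vec_code u) N'"
        by (auto simp: eventually_sequentially)
      \<comment> \<open>One number codes the pattern, the machine input, the time and the place. The
        bound below exceeds it and is also large enough for the occurrence to be visible.\<close>
      let ?j = "prod_encode (c, prod_encode (n, prod_encode (t, vec_code u)))"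
      have "forbidden d a m x (max N (Suc ?j))"
        unfolding forbidden_def
        by (rule exI[of _ ?j])
          (use c p u N vec_lattice[of "vec_code u" d] in \<open>auto simp: in_patterns_iff\<close>)
      then show False using forb by blast
    qed
    ultimately have "y \<in> ?X"
      by (auto simp: effective_subshift_def subshift_def)
    then have y: "y \<in> full_shift d (set_decode b)" "\<And>f. f \<in> Fc \<Longrightarrow> \<not> appears d (pattern_of f) y"
      using XY by (auto simp: subshift_def)
    \<comment> \<open>Finite type enters here: finitely many rules admit a common bound.\<close>
    have "eventually (\<lambda>N. \<forall>f\<in>Fc. \<exists>e\<in>set (list_decode f). pfst e < N \<and> Suc (x (pfst e)) \<noteq> assoc_find f (pfst e)) sequentially"
    proof (intro eventually_ball_finite ballI fin)
      fix f assume f: "f \<in> Fc"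
      obtain s where s: "s \<in> dom (pattern_of f)" "pattern_of f s \<noteq> Some (y (vec_add (replicate d 0) s))"
        using y(2)[OF f] replicate_lattice[of d] unfolding appears_def by blast
      have sl: "s \<in> lattice d" using s(1) F f by (auto simp: patterns_def)
      obtain e where e: "e \<in> set (list_decode f)" "s = vec (pfst e)"
        using s(1) unfolding dom_pattern_of by blast
      have "Suc (x (pfst e)) \<noteq> assoc_find f (pfst e)"
        using s(2) sl by (auto simp: vec_zero_add y_def e(2) pattern_of_vec split: nat.splits)
      then show "\<forall>\<^sub>F N in sequentially. \<exists>e\<in>set (list_decode f). pfst e < N \<and> Suc (x (pfst e)) \<noteq> assoc_find f (pfst e)"
        using e(1) by (intro eventually_mono[OF eventually_gt_at_top[of "pfst e"]]) blast
    qed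
    moreover have "x (vec_code (replicate d 0)) \<in> set_decode b"
      using y(1) replicate_lattice[of d] by (auto simp: full_shift_def y_def dest: PiE_mem)
    ultimately have "eventually (legal_at_origin d b Fc x) sequentially"
      unfolding legal_at_origin_def
      using eventually_gt_at_top[of "vec_code (replicate d 0)"] by (simp add: eventually_conj)
    then show False using legal eventually_happens'[OF sequentially_bot] by blast
  qed
next
  assume settled: "\<forall>x. (\<forall>i. x i \<le> a) \<longrightarrow> (\<exists>N. settled d b Fc a m x N)"
  show "?X \<subseteq> ?Y"
  proof
    fix y assume y: "y \<in> ?X"
    have yA: "v \<in> lattice d \<Longrightarrow> y v \<in> set_decode a" for v
      using y by (auto simp: effective_subshift_def subshift_def full_shift_def dest: PiE_mem)
    have main: "y u \<in> set_decode b \<and> (\<forall>f\<in>Fc. \<exists>s\<in>dom (pattern_of f). pattern_of f s \<noteq> Some (y (vec_add u s)))"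
      if u: "u \<in> lattice d" for u
    proof -
      \<comment> \<open>\<open>x\<close> is \<open>y\<close> translated by \<open>u\<close>, so
        legality at the origin speaks about \<open>y\<close> at \<open>u\<close>. The value 0 at
        codes outside the lattice respects the bound \<open>a\<close>.\<close>
      define x where "x i = (if vec i \<in> lattice d then y (vec_add u (vec i)) else 0)" for i
      have xA: "vec i \<in> lattice d \<Longrightarrow> x i \<in> set_decode a" for i
        using u by (simp add: x_def yA vec_add_lattice)
      have "x i \<le> a" for i
        using xA[of i] set_decode_less[of "x i" a] by (cases "vec i \<in> lattice d") (auto simp: x_def)
      then obtain N where "settled d b Fc a m x N" using settled by blast
      moreover have "\<not> off_alphabet d a x N"
        using xA by (auto simp: off_alphabet_def vec_lattice)
      moreover have "\<not> forbidden d a m x N"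
      proof
        assume "forbidden d a m x N"
        then obtain c n t v where c: "sim_result m n c t" "in_patterns d a c" "vec v \<in> lattice d" "occurs d x c v N"
          by (auto simp: forbidden_def vec_lattice)
        have p: "pattern_of c \<in> patterns d (set_decode a)"
          using c(2) by (simp add: in_patterns_iff)
        have "pattern_of c s = Some (y (vec_add (vec_add u (vec v)) s))" if "s \<in> dom (pattern_of c)" for s
        proof -
          have "vec_add (vec v) s \<in> lattice d"
            using that p c(3) by (intro vec_add_lattice) (auto simp: patterns_def)
          then show ?thesis
            using occursD[OF c(4) p c(3) that] by (simp add: x_def vec_add_assoc)
        qed
        then have "appears d (pattern_of c) y"
          using u c(3) by (auto simp: appears_def intro!: bexI[of _ "vec_add u (vec v)"] vec_add_lattice)
        moreover have "c \<in> tm_enumerates (tm_of m)"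
          using c(1) by (auto simp: tm_enumerates_iff)
        ultimately show False
          using y p by (auto simp: effective_subshift_def subshift_def)
      qed
      ultimately have legal: "legal_at_origin d b Fc x N"
        by (simp add: settled_def)
      have "y u \<in> set_decode b"
        using legal u replicate_lattice[of d] by (simp add: legal_at_origin_def x_def vec_add_zero)
      moreover have "\<exists>s\<in>dom (pattern_of f). pattern_of f s \<noteq> Some (y (vec_add u s))" if f: "f \<in> Fc" for f
      proof -
        obtain e where e: "e \<in> set (list_decode f)" "Suc (x (pfst e)) \<noteq> assoc_find f (pfst e)"
          using legal f by (auto simp: legal_at_origin_def)
        have dom: "vec (pfst e) \<in> dom (pattern_of f)"
          using e(1) unfolding dom_pattern_of by (rule imageI)
        then have "vec (pfst e) \<in> lattice d"
          using F f by (auto simp: patterns_def)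
        then have "pattern_of f (vec (pfst e)) \<noteq> Some (y (vec_add u (vec (pfst e))))"
          using e(2) by (auto simp: pattern_of_vec x_def split: nat.splits)
        then show ?thesis using dom by blast
      qed
      ultimately show ?thesis by blast
    qed
    have "y \<in> extensional (lattice d)"
      using y by (auto simp: effective_subshift_def subshift_def full_shift_def PiE_def)
    then have "y \<in> full_shift d (set_decode b)"
      using main by (auto simp: full_shift_def PiE_def)
    then show "y \<in> ?Y"
      using main by (fastforce simp: subshift_def appears_def)
  qed
qed

text \<open>Koenig's lemma: without a uniform \<open>N\<close>, a prefix that is bad for every
  \<open>N\<close> extends forever by one of finitely many letters. The bound that exists for the
  limit then contradicts the badness of one of its prefixes.\<close>

lemma fan_theorem:
  fixes P :: "(nat \<Rightarrow> nat) \<Rightarrow> nat \<Rightarrow> bool"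
  assumes mono: "\<And>x x' N N'. P x N \<Longrightarrow> N \<le> N' \<Longrightarrow> (\<And>i. i < N \<Longrightarrow> x i = x' i) \<Longrightarrow> P x' N'"
    and all: "\<And>x. (\<And>i. x i \<le> a) \<Longrightarrow> \<exists>N. P x N"
  shows "\<exists>N. \<forall>x. (\<forall>i. x i \<le> a) \<longrightarrow> P x N"
proof (rule ccontr)
  assume contr: "\<nexists>N. \<forall>x. (\<forall>i. x i \<le> a) \<longrightarrow> P x N"
  define bad where "bad xs \<longleftrightarrow> (\<forall>N. \<exists>x. (\<forall>i. x i \<le> a) \<and> (\<forall>i<length xs. x i = xs ! i) \<and> \<not> P x N)" for xs
  have step: "\<exists>c\<le>a. bad (xs @ [c])" if bad: "bad xs" for xs
  proof (rule ccontr)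
    assume "\<not> (\<exists>c\<le>a. bad (xs @ [c]))"
    then have "\<forall>c\<in>{..a}. \<exists>N. \<forall>x. (\<forall>i. x i \<le> a) \<longrightarrow> (\<forall>i<length (xs @ [c]). x i = (xs @ [c]) ! i) \<longrightarrow> P x N"
      unfolding bad_def by (metis atMost_iff)
    then obtain M where M: "\<And>c x. c \<le> a \<Longrightarrow> \<forall>i. x i \<le> a \<Longrightarrow>
        (\<forall>i<length (xs @ [c]). x i = (xs @ [c]) ! i) \<Longrightarrow> P x (M c)"
      by (metis atMost_iff)
    obtain x where x: "\<forall>i. x i \<le> a" "\<forall>i<length xs. x i = xs ! i" "\<not> P x (Max (M ` {..a}))"
      using bad unfolding bad_def by blast
    have "P x (M (x (length xs)))"
      using x by (intro M) (auto simp: nth_append less_Suc_eq)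
    moreover have "M (x (length xs)) \<le> Max (M ` {..a})"
      using x by (intro Max_ge) auto
    ultimately show False using mono x(3) by blast
  qed
  have "\<exists>F. \<forall>n. (length (F n) = n \<and> bad (F n)) \<and> (\<exists>c\<le>a. F (Suc n) = F n @ [c])"
  proof (rule dependent_nat_choice)
    show "\<exists>xs. length xs = 0 \<and> bad xs"
      using contr by (auto simp: bad_def)
    show "\<exists>ys. (length ys = Suc n \<and> bad ys) \<and> (\<exists>c\<le>a. ys = xs @ [c])" if "length xs = n \<and> bad xs" for xs n
      using step[of xs] that by (metis length_append_singleton)
  qed
  then obtain F where F: "\<And>n. length (F n) = n" "\<And>n. bad (F n)" "\<And>n. \<exists>c\<le>a. F (Suc n) = F n @ [c]"
    by blast
  define X where "X i = F (Suc i) ! i" for i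
  have "X i \<le> a" for i
    using F(1,3)[of i] by (auto simp: X_def nth_append)
  then obtain N where N: "P X N" using all by blast
  have X: "i < n \<Longrightarrow> F n ! i = X i" for n i
  proof (induction n)
    case (Suc n)
    then show ?case using F(1,3)[of n] by (cases "i = n") (auto simp: X_def nth_append)
  qed simp
  obtain x where "\<forall>i<N. x i = F N ! i" "\<not> P x N"
    using F(1,2)[of N] unfolding bad_def by metis
  then show False using mono[OF N, of N x] X by simp
qed

lemma prod_encode_mono: "a \<le> a' \<Longrightarrow> b \<le> b' \<Longrightarrow> prod_encode (a, b) \<le> prod_encode (a', b')"
proof -
  assume "a \<le> a'" "b \<le> b'"
  moreover have "m \<le> n \<Longrightarrow> triangle m \<le> triangle n" for m n
    by (rule lift_Suc_mono_le) simp
  ultimately show ?thesis by (simp add: prod_encode_def add_mono)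
qed

text \<open>The code of the constant stream \<open>a\<close> of length \<open>N\<close>. As pairing
  is monotone, it bounds a code for every prefix of this length with values at most
  \<open>a\<close>, so all prefixes are covered by a bounded search.\<close>

definition stream_bound :: "nat \<Rightarrow> nat \<Rightarrow> nat" where
  "stream_bound a N = ((\<lambda>y. prod_encode (a, y)) ^^ N) 0"

lemma stream_below_bound: "(\<And>i. x i \<le> a) \<Longrightarrow> \<exists>w\<le>stream_bound a N. \<forall>i<N. sth w i = x i"
proof (induction N arbitrary: x)
  case (Suc N)
  obtain w where w: "w \<le> stream_bound a N" "\<forall>i<N. sth w i = x (Suc i)"
    using Suc.IH[of "\<lambda>i. x (Suc i)"] Suc.prems by blast
  have "prod_encode (x 0, w) \<le> stream_bound a (Suc N)"
    using w(1) Suc.prems by (simp add: stream_bound_def prod_encode_mono)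
  moreover have "sth (prod_encode (x 0, w)) i = x i" if "i < Suc N" for i
    using w(2) that by (cases i) simp_all
  ultimately show ?case by blast
qed (auto simp: stream_bound_def)

lemma Sigma01_effective_subset:
  assumes F: "pattern_of ` Fc \<subseteq> patterns d (set_decode b)" and fin: "finite Fc"
  shows "Sigma01 {z. effective_subshift d (set_decode (pfst z)) (tm_of (psnd z))
    \<subseteq> subshift d (set_decode b) (pattern_of ` Fc)}"
proof -
  define R where "R z N \<longleftrightarrow> (\<forall>w\<le>stream_bound (pfst z) N. (\<forall>i<N. sth w i \<le> pfst z) \<longrightarrow>
    settled d b Fc (pfst z) (psnd z) (sth w) N)" for z N
  have "prp (\<lambda>z. R (pfst z) (psnd z))"
    unfolding R_def stream_bound_def by (intro pr_intros fin)
  then have "Sigma01 {z. \<exists>N. R z N}" by (rule Sigma01_projection)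
  moreover have "(\<forall>x. (\<forall>i. x i \<le> a) \<longrightarrow> (\<exists>N. settled d b Fc a m x N)) \<longleftrightarrow> (\<exists>N. R (prod_encode (a, m)) N)" for a m
  proof
    assume "\<forall>x. (\<forall>i. x i \<le> a) \<longrightarrow> (\<exists>N. settled d b Fc a m x N)"
    then have "\<exists>N. \<forall>x. (\<forall>i. x i \<le> a) \<longrightarrow> settled d b Fc a m x N"
      using settled_mono by (intro fan_theorem) blast+
    then obtain N where N: "\<And>x. \<forall>i. x i \<le> a \<Longrightarrow> settled d b Fc a m x N" by blast
    \<comment> \<open>Beyond \<open>N\<close> the stream may exceed \<open>a\<close>; cutting it off
      there makes the uniform bound applicable, and the verdict carries back.\<close>
    have "settled d b Fc a m (sth w) N" if "\<forall>i<N. sth w i \<le> a" for w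
      using that by (intro settled_mono[OF N[of "\<lambda>i. if i < N then sth w i else 0"]]) auto
    then have "R (prod_encode (a, m)) N" by (simp add: R_def)
    then show "\<exists>N. R (prod_encode (a, m)) N" ..
  next
    assume "\<exists>N. R (prod_encode (a, m)) N"
    then obtain N where N: "R (prod_encode (a, m)) N" ..
    show "\<forall>x. (\<forall>i. x i \<le> a) \<longrightarrow> (\<exists>N. settled d b Fc a m x N)"
    proof (intro allI impI)
      fix x :: "nat \<Rightarrow> nat" assume x: "\<forall>i. x i \<le> a"
      then obtain w where w: "w \<le> stream_bound a N" "\<forall>i<N. sth w i = x i"
        using stream_below_bound[of x a N] by blast
      then have "settled d b Fc a m (sth w) N"
        using N x by (simp add: R_def)
      then have "settled d b Fc a m x N"
        by (rule settled_mono) (use w in auto)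
      then show "\<exists>N. settled d b Fc a m x N" ..
    qed
  qed
  then have "(\<exists>N. R z N) \<longleftrightarrow> effective_subshift d (set_decode (pfst z)) (tm_of (psnd z))
    \<subseteq> subshift d (set_decode b) (pattern_of ` Fc)" for z
    unfolding effective_subset_iff[OF F fin] by (metis prod_encode_pfst_psnd)
  ultimately show ?thesis by simp
qed

section \<open>Failure of the converse inclusion\<close>

lemma Sigma01_effective_not_superset:
  assumes Y: "Y \<subseteq> full_shift d (set_decode b)" and lang: "language_computable d Y"
  shows "Sigma01 {z. \<not> Y \<subseteq> effective_subshift d (set_decode (pfst z)) (tm_of (psnd z))}"
proof -
  obtain M where M: "finite (dom M)" "\<And>c. tm_result M c (if pattern_of c \<in> language d Y then 1 else 0)"
    using lang unfolding language_computable_def decidable_def computable_def by auto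
  obtain l where l: "tm_of l = M" using tm_of_onto[OF M(1)] by blast
  have lang_iff: "pattern_of c \<in> language d Y \<longleftrightarrow> (\<exists>t. sim_result l c 1 t)" for c
  proof -
    have "pattern_of c \<in> language d Y \<longleftrightarrow> tm_result M c 1"
      using M(2)[of c] tm_result_unique[OF M(2)[of c], of 1] by (cases "pattern_of c \<in> language d Y") auto
    then show ?thesis by (simp only: l[symmetric] tm_result_iff)
  qed
  \<comment> \<open>These are the letters that occur in \<open>Y\<close>, not its alphabet, since an
    input may lack a letter that no point of \<open>Y\<close> uses. As \<open>Y\<close> is fixed,
    this finite set is built into the test.\<close>
  define letters where "letters = (\<Union>y\<in>Y. y ` lattice d)"
  have letters: "finite letters"
    by (rule finite_subset[of _ "set_decode b"]) (use Y in \<open>auto simp: letters_def full_shift_def\<close>)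
  define R where "R z j \<longleftrightarrow> \<not> (\<forall>k\<in>letters. k \<in> set_decode (pfst z)) \<or>
    sim_result (psnd z) (pfst (psnd j)) (pfst j) (pfst (psnd (psnd j))) \<and>
    in_patterns d (pfst z) (pfst j) \<and> sim_result l (pfst j) 1 (psnd (psnd (psnd j)))" for z j
  have "prp (\<lambda>z. R (pfst z) (psnd z))"
    unfolding R_def by (intro pr_intros letters)
  then have "Sigma01 {z. \<exists>j. R z j}" by (rule Sigma01_projection)
  moreover have "(\<exists>j. R z j) \<longleftrightarrow> \<not> Y \<subseteq> effective_subshift d (set_decode (pfst z)) (tm_of (psnd z))" for z
  proof -
    let ?A = "set_decode (pfst z)"
    have "(\<exists>j. R z j) \<longleftrightarrow> \<not> letters \<subseteq> ?A \<or> (\<exists>c n t t'. sim_result (psnd z) n c t \<and> in_patterns d (pfst z) c \<and> sim_result l c 1 t')"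
      (is "?L \<longleftrightarrow> ?R")
    proof
      show "?L \<Longrightarrow> ?R" unfolding R_def by blast
      assume ?R
      then consider "\<not> letters \<subseteq> ?A" | c n t t' where "sim_result (psnd z) n c t" "in_patterns d (pfst z) c" "sim_result l c 1 t'"
        by blast
      then show ?L
      proof cases
        case 2
        then show ?thesis unfolding R_def
          by (intro exI[of _ "prod_encode (c, prod_encode (n, prod_encode (t, t')))"]) simp
      qed (auto simp: R_def)
    qed
    also have "\<dots> \<longleftrightarrow> \<not> letters \<subseteq> ?A \<or> (\<exists>p\<in>pattern_of ` tm_enumerates (tm_of (psnd z)) \<inter> patterns d ?A. p \<in> language d Y)"
    proof -
      have "(\<exists>p\<in>pattern_of ` tm_enumerates (tm_of (psnd z)) \<inter> patterns d ?A. p \<in> language d Y) \<longleftrightarrow>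
          (\<exists>c. c \<in> tm_enumerates (tm_of (psnd z)) \<and> in_patterns d (pfst z) c \<and> pattern_of c \<in> language d Y)"
        unfolding in_patterns_iff by blast
      then show ?thesis unfolding lang_iff tm_enumerates_iff by blast
    qed
    also have "\<dots> \<longleftrightarrow> \<not> Y \<subseteq> effective_subshift d ?A (tm_of (psnd z))"
    proof -
      have "letters \<subseteq> ?A \<longleftrightarrow> Y \<subseteq> full_shift d ?A"
        using Y by (auto simp: letters_def full_shift_def PiE_def) blast+
      moreover have "p \<in> language d Y \<longleftrightarrow> (\<exists>y\<in>Y. appears d p y)" if "p \<in> patterns d ?A" for p
        using that by (auto simp: language_def patterns_def)
      ultimately show ?thesis
        unfolding effective_subshift_def subshift_def by blast
    qed
    finally show ?thesis .
  qed
  ultimately show ?thesis by simp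
qed

section \<open>Machines with a built-in parameter\<close>

text \<open>\<open>Suc (prod_encode (e, m))\<close> is list cons on codes; the new entry takes
  precedence over older ones.\<close>

definition add_transition :: "nat \<Rightarrow> nat \<Rightarrow> nat \<Rightarrow> nat \<Rightarrow> nat \<Rightarrow> nat \<Rightarrow> nat" where
  "add_transition q c q' c' i m =
     Suc (prod_encode (prod_encode (prod_encode (q, c), prod_encode (q', prod_encode (c', i))), m))"

lemma tm_of_add_transition:
  "tm_of (add_transition q c q' c' i m) = (tm_of m)((q, c) \<mapsto> (q', c', move_of i))"
  by (simp add: tm_of_def add_transition_def transition_of_def)

lemma pr_add_transition [pr_intros]:
  assumes "pr q" "pr c" "pr q'" "pr c'" "pr i" "pr m"
  shows "pr (\<lambda>x. add_transition (q x) (c x) (q' x) (c' x) (i x) (m x))"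
  unfolding add_transition_def by (intro pr_intros assms)

text \<open>State \<open>L + 1 + i\<close> marks \<open>i\<close> further cells on track 1, which puts the parameter into register 1
  (the symbols 2 and 3 are 0 and 1 with this mark).\<close>

primrec loader :: "nat \<Rightarrow> nat \<Rightarrow> nat \<Rightarrow> nat" where
  "loader L m 0 = m"
| "loader L m (Suc i) = add_transition (L + 2 + i) 0 (L + 1 + i) 2 2
     (add_transition (L + 2 + i) 1 (L + 1 + i) 3 2 (loader L m i))"

lemma pr_loader [pr_intros]:
  assumes "pr n" shows "pr (\<lambda>x. loader L m (n x))"
proof -
  have "loader L m n = rec_nat m (\<lambda>i r. add_transition (L + 2 + i) 0 (L + 1 + i) 2 2
     (add_transition (L + 2 + i) 1 (L + 1 + i) 3 2 r)) n" for n
    by (induction n) simp_all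
  then show ?thesis by (simp only:) (intro pr_intros assms)
qed

lemma loader_low: "x \<le> L + 1 \<Longrightarrow> tm_of (loader L m n) (x, c) = tm_of m (x, c)"
  by (induction n) (simp_all add: tm_of_add_transition)

lemma loader_high:
  "i < n \<Longrightarrow> c \<in> {0, 1} \<Longrightarrow> tm_of (loader L m n) (L + 2 + i, c) = Some (L + 1 + i, c + 2, MoveRight)"
  by (induction n) (auto simp: tm_of_add_transition move_of_def less_Suc_eq)

text \<open>A form of the s-m-n theorem: only the prologue that loads \<open>n\<close> depends on
  \<open>n\<close>, and its list of transitions is built by primitive recursion.\<close>

lemma parametrization:
  assumes "pr g"
  shows "\<exists>f. pr f \<and> (\<forall>n. tm_enumerates (tm_of (f n)) = range (\<lambda>j. g (prod_encode (j, n))))"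
proof -
  obtain P where P: "\<And>b s s'. (\<And>i. b < i \<Longrightarrow> s i = 0) \<Longrightarrow> s' = s(b := g (s b)) \<Longrightarrow> exec (P b) s s'"
    using assms by (rule prE) blast
  define Q where "Q = Seq (pair_prog 0) (P 0)"
  let ?s = "\<lambda>j n. (\<lambda>_. 0 :: nat)(0 := j, 1 := n)" and ?e = "\<lambda>k. (\<lambda>_. 0 :: nat)(0 := k)"
  have Q: "exec Q (?s j n) (?e (g (prod_encode (j, n))))" for j n
    unfolding Q_def
    by (rule exec_Seq[OF exec_pair_prog[OF _ refl]], simp, rule P) (auto simp: fun_eq_iff)
  obtain K where K: "{0, 1} \<union> regs Q \<subseteq> {..<K}"
    using finite_nat_set_iff_bounded[of "{0, 1} \<union> regs Q"] finite_regs by auto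
  \<comment> \<open>State 0 enters the loader, state 1 walks back to the left end, the program runs
    from state 2 to its exit \<open>L\<close>, and the loader occupies the states above.\<close>
  define L where "L = 2 + num_states Q"
  define M0 where "M0 = (compile K Q 2)((1, 2) \<mapsto> (1, 2, MoveLeft), (1, 3) \<mapsto> (1, 3, MoveLeft),
    (1, 0) \<mapsto> (2, 0, MoveRight), (L + 1, 0) \<mapsto> (1, 0, MoveLeft), (L + 1, 1) \<mapsto> (1, 1, MoveLeft))"
  obtain m0 where m0: "tm_of m0 = M0"
    using tm_of_onto[of M0] by (auto simp: M0_def finite_dom_compile)
  define f where "f n = add_transition 0 0 (L + 1 + n) 0 1 (add_transition 0 1 (L + 1 + n) 1 1 (loader L m0 n))" for n
  have "pr f"
    unfolding f_def by (intro pr_intros)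
  have run: "tm_result (tm_of (f n)) j (g (prod_encode (j, n)))" for n j
  proof -
    let ?M = "tm_of (f n)"
    \<comment> \<open>\<open>t r\<close> is the tape after \<open>r\<close> steps of loading: weight
      1 is the input on track 0, weight 2 the parameter on track 1.\<close>
    define t where "t r i = (if 0 \<le> i \<and> i < int j then 1 else 0) + (if 0 \<le> i \<and> i < int r then 2 else (0::nat))" for r i
    have low: "0 < x \<Longrightarrow> x \<le> L + 1 \<Longrightarrow> ?M (x, c) = M0 (x, c)" for x c
      using loader_low[of x L m0 n c] by (simp add: f_def tm_of_add_transition m0)
    have high: "i < n \<Longrightarrow> c \<in> {0, 1} \<Longrightarrow> ?M (L + 2 + i, c) = Some (L + 1 + i, c + 2, MoveRight)" for i c
      using loader_high[of i n c L m0] by (simp add: f_def tm_of_add_transition)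
    have "r \<le> n \<Longrightarrow> steps ?M (L + 1 + n, 0, t 0) (L + 1 + (n - r), int r, t r)" for r
    proof (induction r)
      case (Suc r)
      have 1: "steps ?M (L + 1 + n, 0, t 0) (L + 1 + (n - r), int r, t r)"
        using Suc by simp
      have 2: "L + 1 + (n - r) = L + 2 + (n - Suc r)"
        using Suc.prems by simp
      have "t (Suc r) = (t r)(int r := t r (int r) + 2)"
        by (auto simp: t_def fun_eq_iff)
      then have "steps ?M (L + 2 + (n - Suc r), int r, t r) (L + 1 + (n - Suc r), int (Suc r), t (Suc r))"
        by - (rule steps_step, rule high, use Suc.prems in simp, simp add: t_def, simp add: add.commute)
      then show ?case by (rule steps_trans[OF 1[unfolded 2]])
    qed simp
    from this[of n] have load: "steps ?M (L + 1 + n, 0, t 0) (L + 1, int n, t n)"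
      by simp
    have tape: "t n = tape K (?s j n)"
    proof (intro ext set_decode_eqD)
      fix i
      have e: "1 = set_encode {0}" "2 = set_encode {1}" "3 = set_encode {0, 1}"
        by (simp_all add: set_encode_def)
      have d: "set_decode 1 = {0}" "set_decode 2 = {1}" "set_decode 3 = {0, 1}"
        by (subst e(1), rule set_encode_inverse, simp) (subst e(2), rule set_encode_inverse, simp,
          subst e(3), rule set_encode_inverse, simp)
      have "1 < K"
        using K by simp
      then have "set_decode (tape K (?s j n) i) =
          (if 0 \<le> i \<and> i < int j then {0} else {}) \<union> (if 0 \<le> i \<and> i < int n then {1} else {})"
        unfolding set_decode_tape by (auto split: if_splits)
      also have "\<dots> = set_decode (if 0 \<le> i \<and> i < int j then if 0 \<le> i \<and> i < int n then 3 else 1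
          else if 0 \<le> i \<and> i < int n then 2 else 0)"
        by (simp only: d if_True if_False Un_empty_left Un_empty_right insert_is_Un[symmetric] set_decode_zero split: if_split) blast
      also have "\<dots> = set_decode (t n i)"
        by (simp add: t_def numeral_2_eq_2 numeral_3_eq_3)
      finally show "set_decode (t n i) = set_decode (tape K (?s j n) i)" ..
    qed
    have init: "tm_init j = (0, 0, t 0)"
      by (simp add: tm_init_def t_def fun_eq_iff)
    have "?M (0, t 0 0) = Some (L + 1 + n, t 0 0, Stay)"
      by (simp add: f_def tm_of_add_transition move_of_def t_def)
    then have "steps ?M (tm_init j) (L + 1 + n, 0, t 0)"
      unfolding init by (rule steps_step) simp
    also note load
    also have "steps ?M (L + 1, int n, t n) (1, int n - 1, t n)"
    proof (rule steps_step)
      show "?M (L + 1, t n (int n)) = Some (1, t n (int n), MoveLeft)"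
        by (simp add: low M0_def t_def L_def)
    qed simp
    also have "steps ?M (1, int n - 1, t n) (1, (int n - 1) - int n, t n)"
      by (rule steps_left) (auto simp: low M0_def t_def L_def)
    also have "steps ?M (1, (int n - 1) - int n, t n) (2, 0, t n)"
    proof (rule steps_step)
      show "?M (1, t n ((int n - 1) - int n)) = Some (2, t n ((int n - 1) - int n), MoveRight)"
        by (simp add: low M0_def t_def L_def)
    qed simp
    also have "steps ?M (2, 0, t n) (2 + num_states Q, 0, tape K (?e (g (prod_encode (j, n)))))"
      unfolding tape
    proof (rule steps_compile[OF Q])
      show "compile K Q 2 \<subseteq>\<^sub>m ?M"
        unfolding map_le_def
      proof
        fix xc assume "xc \<in> dom (compile K Q 2)"
        then obtain x c y where xc: "xc = (x, c)" "compile K Q 2 (x, c) = Some y"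
          by (cases xc) (auto simp: dom_def)
        then have "2 \<le> x" "x < L"
          using compile_SomeD[OF xc(2)] by (simp_all add: L_def)
        then show "compile K Q 2 xc = ?M xc"
          using xc(1) by (simp add: low M0_def)
      qed
    qed (use K in auto)
    finally show ?thesis
      by (rule tm_resultI) (use K compile_final[of K Q 2] in \<open>auto simp: low M0_def L_def\<close>)
  qed
  have "tm_enumerates (tm_of (f n)) = range (\<lambda>j. g (prod_encode (j, n)))" for n
    unfolding tm_enumerates_def using run tm_result_unique by blast
  then show ?thesis using \<open>pr f\<close> by blast
qed

section \<open>Equality of effective subshifts with a fixed subshift of finite type\<close>

lemma Sigma01_imp_tm_of: "Sigma01 S \<Longrightarrow> \<exists>m. S = tm_enumerates (tm_of m)"
  unfolding Sigma01_def using tm_of_onto by metis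

lemma is_SFT_codes:
  assumes "is_SFT d Y"
  obtains b Fc where "finite Fc" "pattern_of ` Fc \<subseteq> patterns d (set_decode b)"
    "Y = subshift d (set_decode b) (pattern_of ` Fc)"
proof -
  obtain A F where AF: "finite A" "finite F" "F \<subseteq> patterns d A" "Y = subshift d A F"
    using assms unfolding is_SFT_def by blast
  have "F \<subseteq> range pattern_of"
  proof
    fix p assume "p \<in> F"
    then have "finite (dom p)" using AF(3) by (auto simp: patterns_def)
    then show "p \<in> range pattern_of" using pattern_of_onto[of p] by auto
  qed
  then obtain Fc where "finite Fc" "F = pattern_of ` Fc"
    using finite_subset_image[OF AF(2)] by metis
  then show ?thesis
    using that[of Fc "set_encode A"] AF by simp
qed

definition single_letter :: "nat \<Rightarrow> nat \<Rightarrow> nat" where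
  "single_letter d k = Suc (prod_encode (prod_encode (vec_code (replicate d 0), k), 0))"

lemma pattern_of_single_letter: "pattern_of (single_letter d k) = [replicate d 0 \<mapsto> k]"
  by (simp add: pattern_of_eq single_letter_def)

lemma appears_letter: "appears d [replicate d 0 \<mapsto> k] x \<longleftrightarrow> k \<in> x ` lattice d"
  unfolding appears_def by (auto simp: vec_add_zero)

lemma letter_pattern: "[replicate d 0 \<mapsto> k] \<in> patterns d A \<longleftrightarrow> k \<in> A"
  by (auto simp: patterns_def lattice_def)

text \<open>As long as \<open>U\<close> has not fired, the configuration that is constantly the new letter \<open>k\<close> is
  allowed; the empty pattern, forbidden once \<open>V\<close> has fired, appears everywhere.\<close>

lemma guarded_subshift_eq_iff:
  assumes F: "F \<subseteq> patterns d B" and k: "k \<notin> B" and Y: "subshift d B F \<noteq> {}"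
  shows "subshift d (insert k B) (F \<union> (if U then {[replicate d 0 \<mapsto> k]} else {}) \<union> (if V then {Map.empty} else {}))
      = subshift d B F \<longleftrightarrow> U \<and> \<not> V" (is "?X = ?Y \<longleftrightarrow> _")
proof (cases V)
  case True
  have "appears d Map.empty x" for x
    using replicate_lattice by (auto simp: appears_def)
  then have "?X = {}"
    using True by (auto simp: subshift_def)
  then show ?thesis using Y True by simp
next
  case False
  show ?thesis
  proof (cases U)
    case True
    have "x \<in> full_shift d B \<longleftrightarrow> x \<in> full_shift d (insert k B) \<and> k \<notin> x ` lattice d" for x
      using k by (auto simp: full_shift_def PiE_def)
    then have "?X = ?Y"
      using True False by (auto simp: subshift_def appears_letter)
    then show ?thesis using True False by simp
  next
    case F': False
    define x where "x = restrict (\<lambda>_. k) (lattice d)"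
    have "\<not> appears d p x" if p: "p \<in> F" for p
    proof
      assume "appears d p x"
      then obtain u where u: "u \<in> lattice d" "\<And>s. s \<in> dom p \<Longrightarrow> p s = Some (x (vec_add u s))"
        by (auto simp: appears_def)
      \<comment> \<open>A nonempty pattern in the constant configuration would use the letter
        \<open>k\<close>, and if the empty pattern were forbidden, \<open>?Y\<close> would have no
        points.\<close>
      have "dom p = {}"
      proof (rule ccontr)
        assume "dom p \<noteq> {}"
        then obtain s where s: "s \<in> dom p" by blast
        then have "vec_add u s \<in> lattice d"
          using F p u(1) by (intro vec_add_lattice) (auto simp: patterns_def)
        then have "p s = Some k"
          using u(2)[OF s] by (simp add: x_def)
        then show False using F p k by (auto simp: patterns_def ran_def)
      qed
      then have "appears d p y" for y
        using u(1) by (auto simp: appears_def)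
      then show False using Y p by (auto simp: subshift_def)
    qed
    then have "x \<in> ?X"
      using False F' by (auto simp: subshift_def full_shift_def x_def)
    moreover have "x \<notin> ?Y"
      using k replicate_lattice[of d] by (auto simp: subshift_def full_shift_def x_def dest: PiE_mem)
    ultimately show ?thesis using False F' by blast
  qed
qed

lemma D_Sigma01_equality_problem:
  assumes "is_SFT d Y" "language_computable d Y"
  shows "D_Sigma01 (equality_problem d Y)"
proof -
  obtain b Fc where Fc: "finite Fc" "pattern_of ` Fc \<subseteq> patterns d (set_decode b)"
    "Y = subshift d (set_decode b) (pattern_of ` Fc)"
    using assms(1) by (rule is_SFT_codes)
  let ?X = "\<lambda>z. effective_subshift d (set_decode (pfst z)) (tm_of (psnd z))"
  have "Sigma01 {z. ?X z \<subseteq> Y}"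
    using Sigma01_effective_subset[OF Fc(2,1)] Fc(3) by simp
  moreover have "Sigma01 {z. \<not> Y \<subseteq> ?X z}"
    by (rule Sigma01_effective_not_superset[of _ _ b]) (use assms Fc in \<open>auto simp: subshift_def\<close>)
  moreover have "equality_problem d Y = {z. ?X z \<subseteq> Y} - {z. \<not> Y \<subseteq> ?X z}"
    by (auto simp: equality_problem_def prod_decode_eq)
  ultimately show ?thesis
    unfolding D_Sigma01_def by blast
qed

section \<open>Hardness: reducing a difference of two \<open>\<Sigma>\<close> sets\<close>

lemma reducible_equality_problem:
  assumes "is_SFT d Y" "Y \<noteq> {}" "D_Sigma01 S"
  shows "many_one_reducible S (equality_problem d Y)"
proof -
  obtain b Fc where Fc: "finite Fc" "pattern_of ` Fc \<subseteq> patterns d (set_decode b)"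
    "Y = subshift d (set_decode b) (pattern_of ` Fc)"
    using assms(1) by (rule is_SFT_codes)
  obtain mu mv where S: "S = tm_enumerates (tm_of mu) - tm_enumerates (tm_of mv)"
    using assms(3) Sigma01_imp_tm_of unfolding D_Sigma01_def by metis
  let ?B = "set_decode b" and ?k = b
  let ?A = "insert ?k ?B"
  \<comment> \<open>The tag \<open>pfst j\<close> selects the source of a pattern, and the rest of
    \<open>j\<close> is the witness. The code 0 is the empty pattern; the last line is the void
    output, whose letter lies outside \<open>?A\<close>.\<close>
  define g where "g z = (let j = pfst z; n = psnd z in
      if pfst j = 0 \<and> psnd j \<in> Fc then psnd j
      else if pfst j = 1 \<and> sim_result mu (pfst (psnd j)) n (psnd (psnd j)) then single_letter d ?k
      else if pfst j = 2 \<and> sim_result mv (pfst (psnd j)) n (psnd (psnd j)) then 0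
      else single_letter d (Suc ?k))" for z
  have "pr g"
    unfolding g_def Let_def by (intro pr_intros Fc)
  then obtain f where f: "pr f" "\<And>n. tm_enumerates (tm_of (f n)) = range (\<lambda>j. g (prod_encode (j, n)))"
    using parametrization by blast
  have k: "?k \<notin> ?B" "Suc ?k \<notin> ?A"
    using set_decode_less[of ?k b] set_decode_less[of "Suc ?k" b] by auto
  have pat: "pattern_of ` tm_enumerates (tm_of (f n)) \<inter> patterns d ?A = pattern_of ` Fc \<union>
      (if n \<in> tm_enumerates (tm_of mu) then {[replicate d 0 \<mapsto> ?k]} else {}) \<union>
      (if n \<in> tm_enumerates (tm_of mv) then {Map.empty} else {})" (is "?L = ?R") for n
  proof -
    \<comment> \<open>The void output is adjoined to both sides, since \<open>g\<close> takes it
      besides the intended values; intersecting with the patterns over \<open>?A\<close> removes it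
      again.\<close>
    have "range (\<lambda>j. g (prod_encode (j, n))) \<union> {single_letter d (Suc ?k)} = Fc \<union>
        (if n \<in> tm_enumerates (tm_of mu) then {single_letter d ?k} else {}) \<union>
        (if n \<in> tm_enumerates (tm_of mv) then {0} else {}) \<union> {single_letter d (Suc ?k)}" (is "?G = ?H")
    proof
      show "?G \<subseteq> ?H"
        by (auto simp: g_def tm_enumerates_iff split: if_splits)
      have "c \<in> range (\<lambda>j. g (prod_encode (j, n)))" if "c \<in> Fc" for c
        using that by (intro range_eqI[of _ _ "prod_encode (0, c)"]) (simp add: g_def)
      moreover have "single_letter d ?k \<in> range (\<lambda>j. g (prod_encode (j, n)))" if U: "n \<in> tm_enumerates (tm_of mu)"
      proof -
        obtain i t where "sim_result mu i n t" using U unfolding tm_enumerates_iff by blast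
        then show ?thesis by (intro range_eqI[of _ _ "prod_encode (1, prod_encode (i, t))"]) (simp add: g_def)
      qed
      moreover have "0 \<in> range (\<lambda>j. g (prod_encode (j, n)))" if V: "n \<in> tm_enumerates (tm_of mv)"
      proof -
        obtain i t where "sim_result mv i n t" using V unfolding tm_enumerates_iff by blast
        then show ?thesis by (intro range_eqI[of _ _ "prod_encode (2, prod_encode (i, t))"]) (simp add: g_def)
      qed
      ultimately show "?H \<subseteq> ?G"
        by auto
    qed
    then have "pattern_of ` ?G = pattern_of ` ?H"
      by (rule arg_cong)
    moreover have "pattern_of ` ?G = pattern_of ` tm_enumerates (tm_of (f n)) \<union> {[replicate d 0 \<mapsto> Suc ?k]}"
      by (simp only: image_Un image_insert image_empty f(2) pattern_of_single_letter)
    moreover have "pattern_of 0 = Map.empty"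
      by (simp add: pattern_of_eq)
    then have "pattern_of ` ?H = ?R \<union> {[replicate d 0 \<mapsto> Suc ?k]}"
      by (simp only: image_Un image_insert image_empty pattern_of_single_letter if_distrib[of "image pattern_of"])
    ultimately have eq: "pattern_of ` tm_enumerates (tm_of (f n)) \<union> {[replicate d 0 \<mapsto> Suc ?k]} =
        ?R \<union> {[replicate d 0 \<mapsto> Suc ?k]}"
      by (simp only:)
    have junk: "[replicate d 0 \<mapsto> Suc ?k] \<notin> patterns d ?A"
      using k(2) by (simp add: letter_pattern)
    have R: "?R \<subseteq> patterns d ?A"
    proof -
      have "pattern_of ` Fc \<subseteq> patterns d ?A"
        using Fc(2) by (auto simp: patterns_def)
      moreover have "[replicate d 0 \<mapsto> ?k] \<in> patterns d ?A"
        by (simp add: letter_pattern)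
      moreover have "Map.empty \<in> patterns d ?A"
        by (simp add: patterns_def)
      ultimately show ?thesis by auto
    qed
    have "S \<inter> T = R" if "S \<union> {q} = R \<union> {q}" "q \<notin> T" "R \<subseteq> T" for S R T and q :: pattern
      using that by blast
    from this[OF eq junk R] show ?thesis .
  qed
  have "prod_encode (set_encode ?A, f n) \<in> equality_problem d Y \<longleftrightarrow> n \<in> S" for n
  proof -
    have "prod_encode (set_encode ?A, f n) \<in> equality_problem d Y \<longleftrightarrow> effective_subshift d ?A (tm_of (f n)) = Y"
      by (simp add: equality_problem_def del: set_encode_insert)
    also have "\<dots> \<longleftrightarrow> n \<in> S"
      unfolding effective_subshift_def pat Fc(3) S
      using guarded_subshift_eq_iff[OF Fc(2) k(1)] assms(2) Fc(3) by simp
    finally show ?thesis .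
  qed
  moreover have "computable (\<lambda>n. prod_encode (set_encode ?A, f n))"
    by (intro pr_computable pr_intros f(1))
  ultimately show ?thesis
    unfolding many_one_reducible_def by blast
qed

theorem proposition7p2:
  fixes d :: nat and Y :: "configuration set"
  assumes "d \<ge> 1"
    and "is_SFT d Y"
    and "Y \<noteq> {}"
    and "language_computable d Y"
  shows "D_Sigma01_complete (equality_problem d Y)"
  unfolding D_Sigma01_complete_def
  using D_Sigma01_equality_problem[OF assms(2,4)] reducible_equality_problem[OF assms(2,3)] by blast

end
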